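(* Let $\rho_1$ be a mixed state and $\rho_2$ a density matrix on $\mathbb{C}^n\otimes\mathbb{C}^n$. If there exists a pure state $|\psi_{\vec{\mu}}\rangle\in\mathbb{C}^n\otimes\mathbb{C}^n$, with Schmidt vector $\vec{\mu}$, such that $\rho_1\in S_{\vec{\mu}}^{+}$ but $\rho_2\notin S_{\vec{\mu}}^{+}$, then the exact LOCC conversion of $\rho_1$ into $\rho_2$ is not possible.
   Context: Setting: two parties, Alice and Bob, each hold a quantum system with Hilbert space $\mathbb{C}^n$. A Schmidt vector is $\vec{\mu}=(\mu^1,\dots,\mu^n)$ with $\mu^1\ge\dots\ge\mu^n\ge 0$ and $\sum_i\mu^i=1$. For a bipartite pure state $|\psi\rangle$, $\vec{\lambda}_\psi$ denotes the vector of Schmidt coefficients in decreasing order, i.e. the eigenvalues, in decreasing order, of $\mathrm{Tr}_A|\psi\rangle\langle\psi|$. Majorization: for vectors with entries in decreasing order and summing to 1, $\vec{\lambda}\succ\vec{\mu}$ means $\sum_{i=1}^k\lambda^i\ge\sum_{i=1}^k\mu^i$ for all $k=1,\dots,n$. LOCC operations: quantum operations built from local quantum operations (including measurements) by Alice and by Bob together with classical communication between them. Exact conversion of $\rho_1$ into $\rho_2$ means that some LOCC operation maps $\rho_1$ to $\rho_2$ deterministically (with probability 1). $\mathrm{LOCC}_1^A$ is the class of operations consisting of a local measurement/superoperator by Alice given by a set of commuting Kraus operators $A_i$ ($\sum_iA_i^\dagger A_i=\mathbf{1}$), followed by one-way classical communication from Alice to Bob, and local unitary transformations by Alice and Bob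 which may depend on Alice's outcome; i.e. maps $\mathcal{L}(\sigma)=\sum_i(U_iA_i\otimes V_i)\,\sigma\,(U_iA_i\otimes V_i)^\dagger$ with $U_i,V_i$ unitary. $S_{\vec{\mu}}$ is the convex closure of the set of (projectors onto) pure states $|\psi\rangle\in\mathbb{C}^n\otimes\mathbb{C}^n$ with $\vec{\lambda}_\psi\succ\vec{\mu}$; for a pure state, $|\psi\rangle\in S_{\vec{\mu}}$ means $|\psi\rangle\langle\psi|\in S_{\vec{\mu}}$. Further, $S_{\vec{\mu}}^{+}=\{\mathcal{L}(|\psi\rangle\langle\psi|)\;|\;\mathcal{L}\in\mathrm{LOCC}_1^A,\ |\psi\rangle\in S_{\vec{\mu}}\}$. *)

theory Defs
  imports
    "HOL-Computational_Algebra.Fundamental_Theorem_Algebra"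
    "Jordan_Normal_Form.Schur_Decomposition"
    "Jordan_Normal_Form.Char_Poly"
begin

text \<open>
  Operators are matrices with explicit dimensions, because the local dimensions
  may change in the course of an LOCC protocol. The basis vector
  \<open>e\<^sub>i \<otimes> e\<^sub>j\<close> of \<open>\<complex>\<^sup>a \<otimes> \<complex>\<^sup>b\<close> has index \<open>i * b + j\<close>; Alice holds the left factor.
\<close>

definition mat_sum :: "nat \<Rightarrow> nat \<Rightarrow> (nat \<Rightarrow> complex mat) \<Rightarrow> complex mat" where
  "mat_sum d m X = mat d d (\<lambda>(r, c). \<Sum>i<m. X i $$ (r, c))"

definition tensor :: "complex mat \<Rightarrow> complex mat \<Rightarrow> complex mat" where
  "tensor A B = mat (dim_row A * dim_row B) (dim_col A * dim_col B)
     (\<lambda>(r, c). A $$ (r div dim_row B, c div dim_col B) * B $$ (r mod dim_row B, c mod dim_col B))"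

definition partial_trace_A :: "nat \<Rightarrow> nat \<Rightarrow> complex mat \<Rightarrow> complex mat" where
  "partial_trace_A a b M = mat b b (\<lambda>(r, c). \<Sum>i<a. M $$ (i * b + r, i * b + c))"

definition unitary :: "nat \<Rightarrow> complex mat \<Rightarrow> bool" where
  "unitary d U \<longleftrightarrow>
     U \<in> carrier_mat d d \<and> U * mat_adjoint U = 1\<^sub>m d \<and> mat_adjoint U * U = 1\<^sub>m d"

text \<open>
  The order on \<open>complex\<close> is that of \<open>Complex_Order\<close>, so \<open>0 \<le> z\<close> includes that \<open>z\<close> is real.
\<close>

definition density_operator :: "nat \<Rightarrow> complex mat \<Rightarrow> bool" where
  "density_operator d \<rho> \<longleftrightarrow>
     \<rho> \<in> carrier_mat d d \<and>
     (\<forall>v \<in> carrier_vec d. 0 \<le> (\<rho> *\<^sub>v v) \<bullet>c v) \<and>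
     (\<Sum>i<d. \<rho> $$ (i, i)) = 1"

definition pure_state :: "nat \<Rightarrow> complex vec \<Rightarrow> bool" where
  "pure_state d \<psi> \<longleftrightarrow> \<psi> \<in> carrier_vec d \<and> \<psi> \<bullet>c \<psi> = 1"

definition projector :: "complex vec \<Rightarrow> complex mat" where
  "projector \<psi> = mat (dim_vec \<psi>) (dim_vec \<psi>) (\<lambda>(r, c). \<psi> $ r * cnj (\<psi> $ c))"


subsection \<open>Schmidt vectors and majorization\<close>

text \<open>
  Eigenvalues are taken with multiplicity, as roots of the characteristic polynomial.
  The reduced operator is Hermitian, so taking \<open>Re\<close> only changes the type.
\<close>

definition schmidt_vector :: "nat \<Rightarrow> complex vec \<Rightarrow> real list" where
  "schmidt_vector n \<psi> =
     rev (sorted_list_of_multiset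
       (image_mset Re (proots (char_poly (partial_trace_A n n (projector \<psi>))))))"

definition majorizes :: "real list \<Rightarrow> real list \<Rightarrow> bool" where
  "majorizes xs ys \<longleftrightarrow>
     length xs = length ys \<and>
     (\<forall>k \<in> {1..length ys}. sum_list (take k xs) \<ge> sum_list (take k ys))"


subsection \<open>LOCC operations\<close>

definition kraus_map :: "nat \<Rightarrow> nat \<Rightarrow> (nat \<Rightarrow> complex mat) \<Rightarrow> complex mat \<Rightarrow> complex mat" where
  "kraus_map d k K \<sigma> = mat_sum d k (\<lambda>j. K j * \<sigma> * mat_adjoint (K j))"

text \<open>
  A local operation on \<open>\<complex>\<^sup>a\<close> with outcomes \<open>i < m\<close>: outcome \<open>i\<close> applies the completely positive
  map with Kraus operators \<open>K i j\<close> (\<open>j < k i\<close>) from \<open>\<complex>\<^sup>a\<close> to a space of dimension \<open>a' i\<close>, and the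
  maps add up to a trace-preserving one. Allowing \<open>k i > 1\<close> covers discarding information, and
  allowing \<open>a' i \<noteq> a\<close> covers adding and removing ancillas.
\<close>

definition instrument ::
    "nat \<Rightarrow> nat \<Rightarrow> (nat \<Rightarrow> nat) \<Rightarrow> (nat \<Rightarrow> nat) \<Rightarrow> (nat \<Rightarrow> nat \<Rightarrow> complex mat) \<Rightarrow> bool" where
  "instrument a m a' k K \<longleftrightarrow>
     (\<forall>i<m. a' i > 0 \<and> (\<forall>j<k i. K i j \<in> carrier_mat (a' i) a)) \<and>
     mat_sum a m (\<lambda>i. mat_sum a (k i) (\<lambda>j. mat_adjoint (K i j) * K i j)) = 1\<^sub>m a"

text \<open>
  \<open>LOCC a b c d \<L>\<close>: the map \<open>\<L>\<close> from operators on \<open>\<complex>\<^sup>a \<otimes> \<complex>\<^sup>b\<close> to operators on \<open>\<complex>\<^sup>c \<otimes> \<complex>\<^sup>d\<close> is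
  implemented by a protocol of finitely many rounds. In each round one party performs a local
  operation and announces the outcome \<open>i\<close>, and the rest of the protocol, \<open>\<L>' i\<close>, may depend on it.
\<close>

inductive LOCC :: "nat \<Rightarrow> nat \<Rightarrow> nat \<Rightarrow> nat \<Rightarrow> (complex mat \<Rightarrow> complex mat) \<Rightarrow> bool" where
  Stop: "LOCC a b a b (\<lambda>\<sigma>. \<sigma>)"
| Alice: "LOCC a b c d
     (\<lambda>\<sigma>. mat_sum (c * d) m
        (\<lambda>i. \<L>' i (kraus_map (a' i * b) (k i) (\<lambda>j. tensor (K i j) (1\<^sub>m b)) \<sigma>)))"
  if "instrument a m a' k K" and "\<forall>i<m. LOCC (a' i) b c d (\<L>' i)"
| Bob: "LOCC a b c d
     (\<lambda>\<sigma>. mat_sum (c * d) m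
        (\<lambda>i. \<L>' i (kraus_map (a * b' i) (k i) (\<lambda>j. tensor (1\<^sub>m a) (K i j)) \<sigma>)))"
  if "instrument b m b' k K" and "\<forall>i<m. LOCC a (b' i) c d (\<L>' i)"

definition LOCC_convertible :: "nat \<Rightarrow> complex mat \<Rightarrow> complex mat \<Rightarrow> bool" where
  "LOCC_convertible n \<rho>\<^sub>1 \<rho>\<^sub>2 \<longleftrightarrow> (\<exists>\<L>. LOCC n n n n \<L> \<and> \<L> \<rho>\<^sub>1 = \<rho>\<^sub>2)"

definition LOCC1A :: "nat \<Rightarrow> (complex mat \<Rightarrow> complex mat) set" where
  "LOCC1A n = {kraus_map (n * n) m (\<lambda>i. tensor (U i * A i) (V i)) | m A U V.
     (\<forall>i<m. A i \<in> carrier_mat n n \<and> unitary n (U i) \<and> unitary n (V i)) \<and>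
     (\<forall>i<m. \<forall>j<m. A i * A j = A j * A i) \<and>
     mat_sum n m (\<lambda>i. mat_adjoint (A i) * A i) = 1\<^sub>m n}"


subsection \<open>The sets of states associated with a Schmidt vector\<close>

definition mat_convex_hull :: "nat \<Rightarrow> complex mat set \<Rightarrow> complex mat set" where
  "mat_convex_hull d S = {mat_sum d m (\<lambda>i. complex_of_real (p i) \<cdot>\<^sub>m X i) | m p X.
     (\<forall>i<m. 0 \<le> p i \<and> X i \<in> S) \<and> (\<Sum>i<m. p i) = (1::real)}"

definition S_states :: "nat \<Rightarrow> real list \<Rightarrow> complex mat set" where
  "S_states n \<mu> = mat_convex_hull (n * n)
     {projector \<psi> | \<psi>. pure_state (n * n) \<psi> \<and> majorizes (schmidt_vector n \<psi>) \<mu>}"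

definition S_plus :: "nat \<Rightarrow> real list \<Rightarrow> complex mat set" where
  "S_plus n \<mu> = {\<L> (projector \<psi>) | \<L> \<psi>.
     \<L> \<in> LOCC1A n \<and> pure_state (n * n) \<psi> \<and> projector \<psi> \<in> S_states n \<mu>}"

end

theory Submission
  imports Defs
begin

text \<open>
  It suffices that \<open>S_plus n \<mu>\<close> is closed under LOCC. An LOCC operation has Kraus operators that are
  tensor products, so they do not increase the Schmidt rank, and the squared norms of the images of
  a vector add up to its own squared norm. Apply them to \<open>\<psi> - w\<close>, where \<open>w\<close> is a best approximation
  of \<open>\<psi>\<close> of Schmidt rank at most \<open>k\<close>: by Eckart--Young the tail sums of the Schmidt vectors can only
  decrease on average, so the average Schmidt vector \<open>\<nu>\<close> of the output ensemble majorizes that of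
  \<open>\<psi>\<close>. The pure state with Schmidt vector \<open>\<nu>\<close> yields the same ensemble by a diagonal measurement of
  Alice and local unitaries, that is, by an operation in \<open>LOCC1A\<close>.
\<close>

subsection \<open>Adjoints, unitaries and the Frobenius norm\<close>

text \<open>A member of \<open>S_plus n \<mu>\<close> is mixed in general, but it arises from one
  pure state; composing its \<open>LOCC1A\<close> operation with the protocol leaves only the branch
  vectors of that pure state to study, so no measure of entanglement for mixed states enters. The
  pure state is known only to lie in a convex hull; extremality of rank-one projectors turns this
  into majorization of \<mu> by its own Schmidt vector. Local dimensions may vary during a protocol,
  so intermediate states are never compared: only the composed Kraus operators count, and they lead
  back to dimension \<open>n * n\<close>. Vectors are read as matrices: \<open>tensor A B\<close>
  becomes M -> A M B^T, Schmidt rank becomes matrix rank, and Schmidt coefficients become squared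
  singular values. Branch vectors stay unnormalised, so their squared singular values already carry
  the outcome probabilities and the average is a plain sum. Best approximation fits because the norm
  identity holds for every vector, hence for \<psi> - w, while the image of w stays an admissible
  competitor in each branch.\<close>

definition vnorm2 :: "complex vec \<Rightarrow> real" where
  "vnorm2 v = (\<Sum>i<dim_vec v. (cmod (v $ i))\<^sup>2)"

text \<open>Squared Hilbert-Schmidt norm. The root is left out because squared norms are what adds
  up over the outcomes of a measurement.\<close>

definition fro :: "complex mat \<Rightarrow> real" where
  "fro M = (\<Sum>i<dim_row M. \<Sum>j<dim_col M. (cmod (M $$ (i, j)))\<^sup>2)"

definition diagm :: "nat \<Rightarrow> (nat \<Rightarrow> real) \<Rightarrow> complex mat" where
  "diagm n d = mat n n (\<lambda>(i, j). if i = j then complex_of_real (d i) else 0)"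

lemma diagm_carrier [simp]: "diagm n d \<in> carrier_mat n n"
  and diagm_dim [simp]: "dim_row (diagm n d) = n" "dim_col (diagm n d) = n"
  and diagm_index [simp]: "i < n \<Longrightarrow> j < n \<Longrightarrow>
    diagm n d $$ (i, j) = (if i = j then complex_of_real (d i) else 0)"
  by (auto simp: diagm_def)

lemma mat_adjoint_index [simp]:
  fixes A :: "complex mat"
  assumes "i < dim_col A" "j < dim_row A"
  shows "mat_adjoint A $$ (i, j) = cnj (A $$ (j, i))"
  using assms by (simp add: mat_adjoint_def mat_of_rows_def conjugate_complex_def)

lemma mat_adjoint_dim [simp]:
  fixes A :: "complex mat"
  shows "dim_row (mat_adjoint A) = dim_col A" "dim_col (mat_adjoint A) = dim_row A"
  by (simp_all add: mat_adjoint_def)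

lemma mat_adjoint_carrier [simp]:
  fixes A :: "complex mat"
  shows "A \<in> carrier_mat m n \<Longrightarrow> mat_adjoint A \<in> carrier_mat n m"
  by (metis carrier_matD carrier_matI mat_adjoint_dim)

lemma index_mult_mat_sum:
  assumes "A \<in> carrier_mat m l" "B \<in> carrier_mat l n" "i < m" "j < n"
  shows "(A * B) $$ (i, j) = (\<Sum>k<l. A $$ (i, k) * B $$ (k, j))"
  using assms by (simp add: scalar_prod_def atLeast0LessThan)

lemma index_mult_mat_vec_sum:
  assumes "A \<in> carrier_mat m l" "v \<in> carrier_vec l" "i < m"
  shows "(A *\<^sub>v v) $ i = (\<Sum>k<l. A $$ (i, k) * v $ k)"
  using assms by (simp add: scalar_prod_def atLeast0LessThan)

lemma mult_carrier_square [simp]: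
  "A \<in> carrier_mat n n \<Longrightarrow> B \<in> carrier_mat n n \<Longrightarrow> A * B \<in> carrier_mat n n"
  by (rule mult_carrier_mat)

lemma mat_adjoint_mult:
  assumes "A \<in> carrier_mat m l" "(B :: complex mat) \<in> carrier_mat l n"
  shows "mat_adjoint (A * B) = mat_adjoint B * mat_adjoint A"
proof (rule eq_matI)
  fix i j assume "i < dim_row (mat_adjoint B * mat_adjoint A)" "j < dim_col (mat_adjoint B * mat_adjoint A)"
  hence ij: "i < n" "j < m" using assms by auto
  have "mat_adjoint (A * B) $$ (i, j) = cnj ((A * B) $$ (j, i))"
    using assms ij by (intro mat_adjoint_index) auto
  also have "\<dots> = (\<Sum>k<l. cnj (A $$ (j, k)) * cnj (B $$ (k, i)))"
    by (subst index_mult_mat_sum[OF assms]) (use ij in auto)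
  also have "\<dots> = (mat_adjoint B * mat_adjoint A) $$ (i, j)"
    by (subst index_mult_mat_sum[of _ n l _ m]) (use assms ij in \<open>auto simp: mult.commute intro!: sum.cong\<close>)
  finally show "mat_adjoint (A * B) $$ (i, j) = (mat_adjoint B * mat_adjoint A) $$ (i, j)" .
qed (use assms in auto)

lemma mat_adjoint_adjoint [simp]: "mat_adjoint (mat_adjoint A) = (A :: complex mat)"
  by (rule eq_matI) auto

lemma mat_adjoint_one [simp]: "mat_adjoint (1\<^sub>m n :: complex mat) = 1\<^sub>m n"
  by (rule eq_matI) auto

lemma unitary_adjoint: "unitary n U \<Longrightarrow> unitary n (mat_adjoint U)"
  by (auto simp: unitary_def)

lemma unitary_mult:
  assumes "unitary n U" "unitary n V"
  shows "unitary n (U * V)"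
proof -
  note U = assms(1)[unfolded unitary_def] and V = assms(2)[unfolded unitary_def]
  have adj: "mat_adjoint (U * V) = mat_adjoint V * mat_adjoint U"
    using U V by (intro mat_adjoint_mult) auto
  have "V * (mat_adjoint V * mat_adjoint U) = (V * mat_adjoint V) * mat_adjoint U"
    by (rule assoc_mult_mat[symmetric]) (use U V in auto)
  hence "U * V * mat_adjoint (U * V) = U * (1\<^sub>m n * mat_adjoint U)"
    using U V unfolding adj by (subst assoc_mult_mat[of _ n n _ n _ n]) auto
  moreover have "mat_adjoint U * (U * V) = (mat_adjoint U * U) * V"
    by (rule assoc_mult_mat[symmetric]) (use U V in auto)
  hence "mat_adjoint (U * V) * (U * V) = mat_adjoint V * (1\<^sub>m n * V)"
    using U V unfolding adj by (subst assoc_mult_mat[of _ n n _ n _ n]) auto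
  ultimately show ?thesis using U V by (auto simp: unitary_def)
qed

text \<open>In finite dimension a one-sided inverse is two-sided, so unitarity reduces to
  orthonormality of the columns.\<close>

lemma unitary_left_inverse:
  assumes "U \<in> carrier_mat n n" "mat_adjoint U * U = 1\<^sub>m n"
  shows "unitary n U"
  using assms mat_mult_left_right_inverse[of "mat_adjoint U" n U] by (auto simp: unitary_def)

text \<open>Transposes enter because an operator B of Bob multiplies the reshaped state by
  \<open>B\<^sup>T\<close> from the right.\<close>

lemma unitary_transpose: assumes "unitary n U" shows "unitary n (U\<^sup>T)"
proof (rule unitary_left_inverse)
  note U = assms[unfolded unitary_def]
  show "mat_adjoint U\<^sup>T * U\<^sup>T = 1\<^sub>m n"
  proof (rule eq_matI)
    fix i j assume "i < dim_row (1\<^sub>m n :: complex mat)" "j < dim_col (1\<^sub>m n :: complex mat)"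
    hence ij: "i < n" "j < n" by auto
    have "(mat_adjoint U\<^sup>T * U\<^sup>T) $$ (i, j) = (U * mat_adjoint U) $$ (j, i)"
      by (subst (1 2) index_mult_mat_sum[of _ n n _ n])
        (use U ij in \<open>auto intro!: sum.cong simp: mult.commute\<close>)
    thus "(mat_adjoint U\<^sup>T * U\<^sup>T) $$ (i, j) = 1\<^sub>m n $$ (i, j)" using U ij by auto
  qed (use U in auto)
qed (use assms in \<open>auto simp: unitary_def\<close>)

lemma cmod_square: "(complex_of_real (cmod z))\<^sup>2 = cnj z * z"
  by (metis complex_norm_square of_real_power mult.commute)

text \<open>Writes the norm as an expression linear in \<open>mat_adjoint K * K\<close>, so that the
  completeness relation of an instrument can be summed inside it.\<close>

lemma fro_mult:
  assumes K: "K \<in> carrier_mat c a" and M: "M \<in> carrier_mat a b"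
  shows "complex_of_real (fro (K * M)) =
    (\<Sum>j<b. \<Sum>p<a. \<Sum>q<a. cnj (M $$ (p, j)) * (mat_adjoint K * K) $$ (p, q) * M $$ (q, j))"
proof -
  have "complex_of_real (fro (K * M)) = (\<Sum>i<c. \<Sum>j<b. cnj ((K * M) $$ (i, j)) * (K * M) $$ (i, j))"
    using K M by (simp add: fro_def cmod_square del: index_mult_mat(1))
  also have "\<dots> = (\<Sum>j<b. \<Sum>i<c. cnj ((K * M) $$ (i, j)) * (K * M) $$ (i, j))"
    by (rule sum.swap)
  also have "\<dots> = (\<Sum>j<b. \<Sum>p<a. \<Sum>q<a. cnj (M $$ (p, j)) * (mat_adjoint K * K) $$ (p, q) * M $$ (q, j))"
  proof (rule sum.cong[OF refl])
    fix j assume "j \<in> {..<b}" hence j: "j < b" by simp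
    have "(\<Sum>i<c. cnj ((K * M) $$ (i, j)) * (K * M) $$ (i, j)) =
      (\<Sum>i<c. \<Sum>p<a. \<Sum>q<a. cnj (M $$ (p, j)) * (cnj (K $$ (i, p)) * K $$ (i, q)) * M $$ (q, j))"
      using j by (simp add: index_mult_mat_sum[OF K M] sum_product del: index_mult_mat(1)) (simp add: mult_ac)
    also have "\<dots> = (\<Sum>p<a. \<Sum>i<c. \<Sum>q<a. cnj (M $$ (p, j)) * (cnj (K $$ (i, p)) * K $$ (i, q)) * M $$ (q, j))"
      by (rule sum.swap)
    also have "\<dots> = (\<Sum>p<a. \<Sum>q<a. \<Sum>i<c. cnj (M $$ (p, j)) * (cnj (K $$ (i, p)) * K $$ (i, q)) * M $$ (q, j))"
      by (intro sum.cong refl sum.swap)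
    also have "\<dots> = (\<Sum>p<a. \<Sum>q<a. cnj (M $$ (p, j)) * (mat_adjoint K * K) $$ (p, q) * M $$ (q, j))"
    proof (intro sum.cong refl)
      fix p q assume "p \<in> {..<a}" "q \<in> {..<a}"
      thus "(\<Sum>i<c. cnj (M $$ (p, j)) * (cnj (K $$ (i, p)) * K $$ (i, q)) * M $$ (q, j)) =
        cnj (M $$ (p, j)) * (mat_adjoint K * K) $$ (p, q) * M $$ (q, j)"
        using K by (simp add: index_mult_mat_sum[of _ a c _ a] sum_distrib_left sum_distrib_right del: index_mult_mat(1))
    qed
    finally show "(\<Sum>i<c. cnj ((K * M) $$ (i, j)) * (K * M) $$ (i, j)) = \<dots>" .
  qed
  finally show ?thesis .
qed

lemma one_quadratic_form:
  fixes M :: "complex mat"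
  assumes M: "M \<in> carrier_mat a b"
  shows "(\<Sum>j<b. \<Sum>p<a. \<Sum>q<a. cnj (M $$ (p, j)) * 1\<^sub>m a $$ (p, q) * M $$ (q, j)) = complex_of_real (fro M)"
proof -
  have "(\<Sum>j<b. \<Sum>p<a. \<Sum>q<a. cnj (M $$ (p, j)) * 1\<^sub>m a $$ (p, q) * M $$ (q, j)) =
    (\<Sum>j<b. \<Sum>p<a. cnj (M $$ (p, j)) * M $$ (p, j))"
  proof (intro sum.cong refl)
    fix j p assume "p \<in> {..<a}"
    hence "(\<Sum>q<a. cnj (M $$ (p, j)) * 1\<^sub>m a $$ (p, q) * M $$ (q, j)) =
      (\<Sum>q<a. if p = q then cnj (M $$ (p, j)) * M $$ (q, j) else 0)"
      by (intro sum.cong refl) auto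
    thus "(\<Sum>q<a. cnj (M $$ (p, j)) * 1\<^sub>m a $$ (p, q) * M $$ (q, j)) = cnj (M $$ (p, j)) * M $$ (p, j)"
      using \<open>p \<in> {..<a}\<close> by simp
  qed
  also have "\<dots> = (\<Sum>p<a. \<Sum>j<b. cnj (M $$ (p, j)) * M $$ (p, j))" by (rule sum.swap)
  also have "\<dots> = complex_of_real (fro M)"
    using M by (simp add: fro_def cmod_square)
  finally show ?thesis .
qed

lemma fro_isometry_mult:
  assumes "U \<in> carrier_mat c a" "mat_adjoint U * U = 1\<^sub>m a" "M \<in> carrier_mat a b"
  shows "fro (U * M) = fro M"
  using fro_mult[OF assms(1,3)] one_quadratic_form[OF assms(3)] assms(2) by simp

lemma fro_transpose: "fro (M\<^sup>T) = fro M"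
  unfolding fro_def by (subst sum.swap) simp

lemma fro_mult_unitary:
  assumes "unitary n U" "M \<in> carrier_mat n b" shows "fro (U * M) = fro M"
  using assms by (intro fro_isometry_mult) (auto simp: unitary_def)

lemma fro_unitary_right:
  assumes "unitary n V" "M \<in> carrier_mat b n" shows "fro (M * V) = fro M"
proof -
  have "fro (M * V) = fro (V\<^sup>T * M\<^sup>T)"
    using assms transpose_mult[of M b n V n] fro_transpose[of "M * V"] by (auto simp: unitary_def)
  thus ?thesis using fro_mult_unitary[OF unitary_transpose[OF assms(1)], of "M\<^sup>T" b] assms(2)
    by (simp add: fro_transpose)
qed

text \<open>By \<open>fro_mult\<close> the left side depends on \<open>K\<close> only through the
  sum of all Gram matrices \<open>mat_adjoint (K i j) * K i j\<close>, which is the identity. This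
  is trace preservation, read on unnormalised pure states.\<close>

lemma instrument_fro:
  assumes inst: "instrument a m a' k K" and M: "M \<in> carrier_mat a b"
  shows "(\<Sum>i<m. \<Sum>j<k i. fro (K i j * M)) = fro M"
proof -
  let ?G = "\<lambda>p q. \<Sum>i<m. \<Sum>j<k i. (mat_adjoint (K i j) * K i j) $$ (p, q)"
  have car: "K i j \<in> carrier_mat (a' i) a" if "i < m" "j < k i" for i j
    using inst that by (auto simp: instrument_def)
  have G: "?G p q = 1\<^sub>m a $$ (p, q)" if "p < a" "q < a" for p q
  proof -
    have "1\<^sub>m a $$ (p, q) = mat_sum a m (\<lambda>i. mat_sum a (k i) (\<lambda>j. mat_adjoint (K i j) * K i j)) $$ (p, q)"
      using inst by (simp add: instrument_def)
    thus ?thesis using that by (simp add: mat_sum_def)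
  qed
  let ?t = "\<lambda>v p q. cnj (M $$ (p, v)) * M $$ (q, v)"
  have "complex_of_real (\<Sum>i<m. \<Sum>j<k i. fro (K i j * M)) =
    (\<Sum>i<m. \<Sum>j<k i. (\<Sum>v<b. \<Sum>p<a. \<Sum>q<a. cnj (M $$ (p, v)) * (mat_adjoint (K i j) * K i j) $$ (p, q) * M $$ (q, v)))"
    by (simp add: fro_mult[OF car M] del: index_mult_mat(1))
  \<comment> \<open>Pairs and triples of indices are packed into single sums so that one exchange of
    summation suffices.\<close>
  also have "\<dots> = (\<Sum>(i, j) \<in> Sigma {..<m} (\<lambda>i. {..<k i}). \<Sum>(v, p, q) \<in> {..<b} \<times> {..<a} \<times> {..<a}.
      cnj (M $$ (p, v)) * (mat_adjoint (K i j) * K i j) $$ (p, q) * M $$ (q, v))"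
    by (simp add: sum.Sigma[symmetric] sum.cartesian_product[symmetric] del: index_mult_mat(1))
  also have "\<dots> = (\<Sum>(v, p, q) \<in> {..<b} \<times> {..<a} \<times> {..<a}. \<Sum>(i, j) \<in> Sigma {..<m} (\<lambda>i. {..<k i}).
      cnj (M $$ (p, v)) * (mat_adjoint (K i j) * K i j) $$ (p, q) * M $$ (q, v))"
    unfolding case_prod_unfold by (rule sum.swap)
  also have "\<dots> = (\<Sum>(v, p, q) \<in> {..<b} \<times> {..<a} \<times> {..<a}. cnj (M $$ (p, v)) * ?G p q * M $$ (q, v))"
    by (simp add: sum.Sigma case_prod_unfold sum_distrib_left sum_distrib_right del: index_mult_mat(1))
  also have "\<dots> = (\<Sum>v<b. \<Sum>p<a. \<Sum>q<a. cnj (M $$ (p, v)) * 1\<^sub>m a $$ (p, q) * M $$ (q, v))"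
    by (simp add: sum.cartesian_product[symmetric] G del: index_mult_mat(1) index_one_mat(1))
  also have "\<dots> = complex_of_real (fro M)" by (rule one_quadratic_form[OF M])
  finally show ?thesis using of_real_eq_iff by blast
qed

subsection \<open>Singular value decomposition\<close>

lemma cscalar_prod_sum:
  assumes "(x :: complex vec) \<in> carrier_vec n" "y \<in> carrier_vec n"
  shows "x \<bullet>c y = (\<Sum>i<n. x $ i * cnj (y $ i))"
  using assms by (simp add: scalar_prod_def atLeast0LessThan conjugate_complex_def)

lemma cscalar_prod_cnj:
  assumes "(x :: complex vec) \<in> carrier_vec n" "y \<in> carrier_vec n"
  shows "x \<bullet>c y = cnj (y \<bullet>c x)"
  using assms by (simp add: cscalar_prod_sum[of _ n] mult.commute)

lemma cscalar_prod_self: "v \<bullet>c v = complex_of_real (vnorm2 v)"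
  by (simp add: cscalar_prod_sum[of _ "dim_vec v"] vnorm2_def cmod_square mult.commute)

lemma vnorm2_nonneg: "0 \<le> vnorm2 v"
  unfolding vnorm2_def by (intro sum_nonneg) auto

lemma vnorm2_eq_0: 
  assumes "v \<in> carrier_vec n" shows "vnorm2 v = 0 \<longleftrightarrow> v = 0\<^sub>v n"
proof -
  have "vnorm2 v = 0 \<longleftrightarrow> (\<forall>i<n. v $ i = 0)"
    using assms unfolding vnorm2_def by (subst sum_nonneg_eq_0_iff) auto
  thus ?thesis using assms by (auto intro: eq_vecI)
qed

lemma vnorm2_smult: "vnorm2 (c \<cdot>\<^sub>v v) = (cmod c)\<^sup>2 * vnorm2 v"
  by (simp add: vnorm2_def norm_mult power_mult_distrib sum_distrib_left)

lemma normalise: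
  assumes v: "v \<in> carrier_vec n" "v \<noteq> 0\<^sub>v n"
  shows "\<exists>c. c \<noteq> 0 \<and> vnorm2 (complex_of_real c \<cdot>\<^sub>v v) = 1"
proof -
  have "vnorm2 v > 0" using vnorm2_nonneg[of v] vnorm2_eq_0[OF v(1)] v(2) by linarith
  thus ?thesis
    by (intro exI[of _ "1 / sqrt (vnorm2 v)"]) (auto simp: vnorm2_smult norm_divide power_divide)
qed

text \<open>Fewer than n linear conditions in dimension n have a nonzero solution; padding them to a
  square matrix makes the determinant criterion yield it. The \<open>x i\<close> may be dependent or
  zero.\<close>

lemma exists_orthogonal_unit:
  fixes x :: "nat \<Rightarrow> complex vec"
  assumes r: "r < n" and x: "\<And>i. i < r \<Longrightarrow> x i \<in> carrier_vec n"
  shows "\<exists>z \<in> carrier_vec n. vnorm2 z = 1 \<and> (\<forall>i<r. x i \<bullet>c z = 0)"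
proof -
  \<comment> \<open>Conjugation makes row i compute the inner product with \<open>x i\<close>. Row
    \<open>r\<close> exists and is zero because r < n, so the transpose kills
    \<open>unit_vec n r\<close> and \<open>B\<close> is singular.\<close>
  define B where "B = mat n n (\<lambda>(i, j). if i < r then cnj (x i $ j) else 0)"
  have B: "B \<in> carrier_mat n n" by (simp add: B_def)
  have "B\<^sup>T *\<^sub>v unit_vec n r = 0\<^sub>v n"
  proof (rule eq_vecI)
    fix i assume "i < dim_vec (0\<^sub>v n :: complex vec)"
    thus "(B\<^sup>T *\<^sub>v unit_vec n r) $ i = 0\<^sub>v n $ i" using r by (simp add: B_def)
  qed (simp add: B_def)
  moreover have "unit_vec n r \<noteq> (0\<^sub>v n :: complex vec)"
    using r by (metis index_unit_vec(1) index_zero_vec(1) zero_neq_one)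
  ultimately have "det (B\<^sup>T) = 0"
    using B by (subst det_0_iff_vec_prod_zero[of _ n]) (auto intro!: exI[of _ "unit_vec n r"])
  hence "det B = 0" using det_transpose[OF B] by simp
  then obtain v where v: "v \<in> carrier_vec n" "v \<noteq> 0\<^sub>v n" "B *\<^sub>v v = 0\<^sub>v n"
    using det_0_iff_vec_prod_zero[OF B] by auto
  obtain c where c: "c \<noteq> 0" "vnorm2 (complex_of_real c \<cdot>\<^sub>v v) = 1" using normalise[OF v(1,2)] by auto
  have "x i \<bullet>c (complex_of_real c \<cdot>\<^sub>v v) = 0" if "i < r" for i
  proof -
    have "0 = (B *\<^sub>v v) $ i" using v(3) that r by simp
    also have "\<dots> = (\<Sum>j<n. cnj (x i $ j) * v $ j)"
      using that r v by (subst index_mult_mat_vec_sum[OF B v(1)]) (auto simp: B_def)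
    finally have "cnj (\<Sum>j<n. cnj (x i $ j) * v $ j) = 0" by simp
    hence "(\<Sum>j<n. x i $ j * cnj (v $ j)) = 0" by simp
    hence "of_real c * (\<Sum>j<n. x i $ j * cnj (v $ j)) = 0" by simp
    thus ?thesis using x[OF that] v by (subst cscalar_prod_sum[of _ n]) (auto simp: sum_distrib_left mult_ac)
  qed
  thus ?thesis using c v by (intro bexI[of _ "complex_of_real c \<cdot>\<^sub>v v"]) auto
qed

definition orthonormal :: "nat \<Rightarrow> nat \<Rightarrow> (nat \<Rightarrow> complex vec) \<Rightarrow> bool" where
  "orthonormal n s z \<longleftrightarrow> (\<forall>i<s. z i \<in> carrier_vec n) \<and>
     (\<forall>i<s. \<forall>j<s. z i \<bullet>c z j = (if i = j then 1 else 0))"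

text \<open>Serves twice: with orthonormal \<open>x\<close> it completes a basis; with
  \<open>x\<close> the columns of a factor of a matrix of rank at most k it yields n - k directions
  orthogonal to its range. Such columns can be dependent, so \<open>x\<close> is arbitrary.\<close>

lemma orthonormal_complement:
  fixes x :: "nat \<Rightarrow> complex vec"
  assumes x: "\<And>i. i < k \<Longrightarrow> x i \<in> carrier_vec n" and "k + s \<le> n"
  shows "\<exists>z. orthonormal n s z \<and> (\<forall>l<k. \<forall>i<s. x l \<bullet>c z i = 0)"
  using assms(2)
proof (induction s)
  case 0
  show ?case by (simp add: orthonormal_def)
next
  case (Suc s)
  then obtain z where z: "orthonormal n s z" "\<forall>l<k. \<forall>i<s. x l \<bullet>c z i = 0" by auto
  note zc = z(1)[unfolded orthonormal_def]
  \<comment> \<open>The given vectors and those found so far are joined into one family of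
    \<open>k + s\<close> vectors, fewer than n.\<close>
  have "(if i < k then x i else z (i - k)) \<in> carrier_vec n" if "i < k + s" for i
    using that x zc by auto
  from exists_orthogonal_unit[of "k + s" n "\<lambda>i. if i < k then x i else z (i - k)", OF _ this] Suc.prems
  obtain w where w: "w \<in> carrier_vec n" "vnorm2 w = 1"
    "\<forall>i<k + s. (if i < k then x i else z (i - k)) \<bullet>c w = 0" by auto
  have xw: "x i \<bullet>c w = 0" if "i < k" for i using w(3) that by (metis trans_less_add1)
  have zw: "z i \<bullet>c w = 0" if "i < s" for i using w(3)[rule_format, of "i + k"] that by simp
  hence wz: "w \<bullet>c z i = 0" if "i < s" for i
    using that cscalar_prod_cnj[of w n "z i"] w zc by simp
  have "orthonormal n (Suc s) (z(s := w))"
    using zc w zw wz cscalar_prod_self[of w] by (auto simp: orthonormal_def less_Suc_eq)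
  moreover have "\<forall>l<k. \<forall>i<Suc s. x l \<bullet>c (z(s := w)) i = 0"
    using z(2) xw by (auto simp: less_Suc_eq)
  ultimately show ?case by blast
qed

lemma unitary_of_orthonormal:
  assumes z: "orthonormal n n z"
  shows "unitary n (mat n n (\<lambda>(i, j). z j $ i))" (is "unitary n ?U")
proof (rule unitary_left_inverse)
  show "mat_adjoint ?U * ?U = 1\<^sub>m n"
  proof (rule eq_matI)
    fix i j assume "i < dim_row (1\<^sub>m n :: complex mat)" "j < dim_col (1\<^sub>m n :: complex mat)"
    hence ij: "i < n" "j < n" by auto
    have "(mat_adjoint ?U * ?U) $$ (i, j) = (\<Sum>k<n. cnj (z i $ k) * z j $ k)"
      by (subst index_mult_mat_sum[of _ n n _ n]) (use ij in auto)
    also have "\<dots> = z j \<bullet>c z i"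
      using z ij by (subst cscalar_prod_sum[of _ n]) (auto simp: orthonormal_def mult.commute)
    finally show "(mat_adjoint ?U * ?U) $$ (i, j) = 1\<^sub>m n $$ (i, j)"
      using z ij by (auto simp: orthonormal_def)
  qed auto
qed simp

lemma unitary_with_first_columns:
  assumes z: "orthonormal n s z" and s: "s \<le> n"
  shows "\<exists>U. unitary n U \<and> (\<forall>j<s. col U j = z j)"
proof -
  have zc: "z i \<in> carrier_vec n" if "i < s" for i using z that by (simp add: orthonormal_def)
  obtain w where w: "orthonormal n (n - s) w" "\<forall>l<s. \<forall>i<n - s. z l \<bullet>c w i = 0"
    using orthonormal_complement[of s z n "n - s"] zc s by auto
  have wz: "w i \<bullet>c z l = 0" if "l < s" "i < n - s" for i l
    using that w cscalar_prod_cnj[of "w i" n "z l"] zc by (simp add: orthonormal_def)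
  define y where "y i = (if i < s then z i else w (i - s))" for i
  have y: "orthonormal n n y"
    using z w wz s unfolding orthonormal_def y_def by auto
  let ?U = "mat n n (\<lambda>(i, j). y j $ i)"
  have "col ?U j = z j" if "j < s" for j
    using that s zc[OF that] by (intro eq_vecI) (auto simp: y_def)
  thus ?thesis using unitary_of_orthonormal[OF y] by blast
qed

lemma adjoint_cscalar_prod:
  assumes "A \<in> carrier_mat m n" "v \<in> carrier_vec n" "w \<in> carrier_vec m"
  shows "(A *\<^sub>v v) \<bullet>c (w :: complex vec) = v \<bullet>c (mat_adjoint A *\<^sub>v w)"
proof -
  have "(A *\<^sub>v v) \<bullet>c w = (\<Sum>i<m. \<Sum>j<n. A $$ (i, j) * v $ j * cnj (w $ i))"
    using assms by (subst cscalar_prod_sum[of _ m])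
      (auto simp: index_mult_mat_vec_sum[of _ m n] sum_distrib_right simp del: index_mult_mat_vec)
  also have "\<dots> = (\<Sum>j<n. \<Sum>i<m. A $$ (i, j) * v $ j * cnj (w $ i))" by (rule sum.swap)
  also have "\<dots> = v \<bullet>c (mat_adjoint A *\<^sub>v w)"
    using assms mult_mat_vec_carrier[of "mat_adjoint A" n m w] by (subst cscalar_prod_sum[of _ n])
      (auto simp: index_mult_mat_vec_sum[of _ n m] sum_distrib_left mult_ac simp del: index_mult_mat_vec)
  finally show ?thesis .
qed

text \<open>Take a unit eigenvector v of the Gram matrix \<open>mat_adjoint M * M\<close>; u is M v
  normalised, and \<sigma> is the norm of M v. If M v = 0, the direction of u has to come from the
  kernel of the adjoint instead.\<close>

lemma singular_pair:
  assumes M: "M \<in> carrier_mat n n" and n: "n > 0"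
  shows "\<exists>u v \<sigma>. u \<in> carrier_vec n \<and> v \<in> carrier_vec n \<and> vnorm2 u = 1 \<and> vnorm2 v = 1 \<and> \<sigma> \<ge> 0 \<and>
    M *\<^sub>v v = complex_of_real \<sigma> \<cdot>\<^sub>v u \<and> mat_adjoint M *\<^sub>v u = complex_of_real \<sigma> \<cdot>\<^sub>v v"
proof -
  let ?H = "mat_adjoint M * M"
  have aM: "mat_adjoint M \<in> carrier_mat n n" using M by simp
  have H: "?H \<in> carrier_mat n n" using aM M by (rule mult_carrier_mat)
  have "degree (char_poly ?H) = n" using degree_monic_char_poly[OF H] by simp
  hence "\<not> constant (poly (char_poly ?H))" using n by (simp add: constant_degree)
  then obtain l where "poly (char_poly ?H) l = 0" using fundamental_theorem_of_algebra by blast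
  hence "eigenvalue ?H l" using eigenvalue_root_char_poly[OF H] by simp
  then obtain v0 where v0: "v0 \<in> carrier_vec n" "v0 \<noteq> 0\<^sub>v n" "?H *\<^sub>v v0 = l \<cdot>\<^sub>v v0"
    using M by (auto simp: eigenvalue_def eigenvector_def)
  obtain c where c: "c \<noteq> 0" "vnorm2 (complex_of_real c \<cdot>\<^sub>v v0) = 1" using normalise[OF v0(1,2)] by auto
  define v where "v = complex_of_real c \<cdot>\<^sub>v v0"
  have v: "v \<in> carrier_vec n" "vnorm2 v = 1" using v0 c by (auto simp: v_def)
  have "?H *\<^sub>v v = l \<cdot>\<^sub>v v"
    using H v0 by (simp add: v_def mult_mat_vec smult_smult_assoc mult.commute)
  hence Hv: "mat_adjoint M *\<^sub>v (M *\<^sub>v v) = l \<cdot>\<^sub>v v"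
    using assoc_mult_mat_vec[OF aM M v(1)] by simp
  define w where "w = M *\<^sub>v v"
  have w: "w \<in> carrier_vec n" using M v by (simp add: w_def)
  \<comment> \<open>Pairing the eigenvalue equation with v identifies the eigenvalue as the squared
    norm of M v, hence real and nonnegative.\<close>
  have "complex_of_real (vnorm2 w) = v \<bullet>c (l \<cdot>\<^sub>v v)"
    using adjoint_cscalar_prod[OF M v(1) w] Hv by (simp add: w_def cscalar_prod_self)
  also have "\<dots> = cnj l * (v \<bullet>c v)"
    using v by (simp add: cscalar_prod_sum[of _ n] sum_distrib_left mult_ac)
  finally have "cnj l = complex_of_real (vnorm2 w)" using v by (simp add: cscalar_prod_self)
  hence l: "l = complex_of_real (vnorm2 w)" by (metis complex_cnj_cnj complex_cnj_complex_of_real)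
  show ?thesis
  proof (cases "w = 0\<^sub>v n")
    case False
    hence pos: "vnorm2 w > 0" using vnorm2_nonneg[of w] vnorm2_eq_0[OF w] by linarith
    define s where "s = sqrt (vnorm2 w)"
    have s: "s > 0" "s\<^sup>2 = vnorm2 w" using pos by (auto simp: s_def)
    define u where "u = complex_of_real (1 / s) \<cdot>\<^sub>v w"
    have u: "u \<in> carrier_vec n" using w by (simp add: u_def)
    have "vnorm2 u = (1 / s)\<^sup>2 * vnorm2 w" using s(1) unfolding u_def vnorm2_smult by (simp add: norm_divide)
    hence u1: "vnorm2 u = 1" using s pos by (simp add: power_divide)
    have 1: "M *\<^sub>v v = complex_of_real s \<cdot>\<^sub>v u" using s w by (simp add: u_def smult_smult_assoc w_def[symmetric])
    have "mat_adjoint M *\<^sub>v u = complex_of_real (1 / s) \<cdot>\<^sub>v (l \<cdot>\<^sub>v v)"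
      using Hv aM w unfolding u_def w_def[symmetric] by (simp add: mult_mat_vec)
    also have "\<dots> = complex_of_real s \<cdot>\<^sub>v v" using s unfolding l s(2)[symmetric]
      by (simp add: smult_smult_assoc power2_eq_square)
    finally show ?thesis using 1 u u1 v s by (intro exI[of _ u] exI[of _ v] exI[of _ s]) auto
  next
    case True
    have vnz: "v \<noteq> 0\<^sub>v n" using v(2) vnorm2_eq_0[OF v(1)] by auto
    \<comment> \<open>A singular M has a left null vector as well: conjugating a kernel vector of
      the transpose gives one of the adjoint.\<close>
    have "det M = 0" using True v vnz det_0_iff_vec_prod_zero[OF M] by (auto simp: w_def)
    hence "det (M\<^sup>T) = 0" using det_transpose[OF M] by simp
    then obtain x where x: "x \<in> carrier_vec n" "x \<noteq> 0\<^sub>v n" "M\<^sup>T *\<^sub>v x = 0\<^sub>v n"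
      using det_0_iff_vec_prod_zero[of "M\<^sup>T" n] M by auto
    obtain c where c: "c \<noteq> 0" "vnorm2 (complex_of_real c \<cdot>\<^sub>v x) = 1" using normalise[OF x(1,2)] by auto
    define u where "u = conjugate (complex_of_real c \<cdot>\<^sub>v x)"
    have u: "u \<in> carrier_vec n" using x by (simp add: u_def)
    have u1: "vnorm2 u = 1" using c by (simp add: u_def vnorm2_def conjugate_complex_def norm_mult)
    have "mat_adjoint M *\<^sub>v u = 0\<^sub>v n"
    proof (rule eq_vecI)
      fix i assume "i < dim_vec (0\<^sub>v n :: complex vec)"
      hence i: "i < n" by simp
      have "0 = cnj (complex_of_real c * (M\<^sup>T *\<^sub>v x) $ i)" using x i by simp
      also have "\<dots> = (mat_adjoint M *\<^sub>v u) $ i"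
        using i M x by (subst (1 2) index_mult_mat_vec_sum[of _ n n])
          (auto simp: u_def conjugate_complex_def sum_distrib_left mult_ac)
      finally show "(mat_adjoint M *\<^sub>v u) $ i = 0\<^sub>v n $ i" using i by simp
    qed (use M in simp)
    thus ?thesis using True u u1 v
      by (intro exI[of _ u] exI[of _ v] exI[of _ 0]) (auto simp: w_def[symmetric])
  qed
qed

lemma unitary_block:
  assumes U: "unitary n U"
  shows "unitary (Suc n) (four_block_mat (1\<^sub>m 1) (0\<^sub>m 1 n) (0\<^sub>m n 1) U)" (is "unitary _ ?B")
proof (rule unitary_left_inverse)
  have Uc: "U \<in> carrier_mat n n" "mat_adjoint U * U = 1\<^sub>m n" using U by (auto simp: unitary_def)
  show "?B \<in> carrier_mat (Suc n) (Suc n)" using Uc by auto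
  have adj: "mat_adjoint ?B = four_block_mat (1\<^sub>m 1) (0\<^sub>m 1 n) (0\<^sub>m n 1) (mat_adjoint U)"
    by (rule eq_matI) (use Uc in auto)
  have "mat_adjoint ?B * ?B = four_block_mat (1\<^sub>m 1) (0\<^sub>m 1 n) (0\<^sub>m n 1) (1\<^sub>m n)"
    unfolding adj by (subst mult_four_block_mat[of _ 1 1 _ n _ n _ _ 1 _ n]) (use Uc in auto)
  also have "\<dots> = 1\<^sub>m (Suc n)" by (rule eq_matI) auto
  finally show "mat_adjoint ?B * ?B = 1\<^sub>m (Suc n)" .
qed

lemma unitary_with_first_column:
  assumes "v \<in> carrier_vec (Suc n)" "vnorm2 v = 1"
  shows "\<exists>U. unitary (Suc n) U \<and> col U 0 = v"
  using unitary_with_first_columns[of "Suc n" 1 "\<lambda>_. v"] assms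
  by (auto simp: orthonormal_def cscalar_prod_self)

text \<open>Deflation: in bases that begin with a singular pair u, v, the first row and the first
  column of M vanish off the diagonal, and induction treats the remaining block.\<close>

lemma svd_unsorted:
  assumes "M \<in> carrier_mat n n"
  shows "\<exists>U V d. unitary n U \<and> unitary n V \<and> (\<forall>i<n. 0 \<le> d i) \<and> M = U * diagm n d * V"
  using assms
proof (induction n arbitrary: M)
  case 0
  show ?case
    by (rule exI[of _ "1\<^sub>m 0"], rule exI[of _ "1\<^sub>m 0"], rule exI[of _ "\<lambda>_. 0"])
       (use 0 in \<open>auto simp: unitary_def\<close>)
next
  case (Suc n)
  let ?n = "Suc n"
  obtain u v \<sigma> where uv: "u \<in> carrier_vec ?n" "v \<in> carrier_vec ?n" "vnorm2 u = 1" "vnorm2 v = 1" "\<sigma> \<ge> 0"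
    and Mv: "M *\<^sub>v v = complex_of_real \<sigma> \<cdot>\<^sub>v u" and Mu: "mat_adjoint M *\<^sub>v u = complex_of_real \<sigma> \<cdot>\<^sub>v v"
    using singular_pair[OF Suc.prems] by auto
  obtain U0 where U0: "unitary ?n U0" "col U0 0 = u" using unitary_with_first_column uv by blast
  obtain V0 where V0: "unitary ?n V0" "col V0 0 = v" using unitary_with_first_column uv by blast
  note cU = U0(1)[unfolded unitary_def] and cV = V0(1)[unfolded unitary_def]
  define N where "N = mat_adjoint U0 * (M * V0)"
  have N: "N \<in> carrier_mat ?n ?n" unfolding N_def using cU cV Suc.prems by (intro mult_carrier_mat[of _ ?n ?n] mat_adjoint_carrier) auto
  \<comment> \<open>Used for N and again for its adjoint, to obtain the first column and the first
    row of N.\<close>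
  have first: "col (mat_adjoint W * (A * Z)) 0 = complex_of_real \<sigma> \<cdot>\<^sub>v unit_vec ?n 0"
    if "unitary ?n W" "Z \<in> carrier_mat ?n ?n" "A \<in> carrier_mat ?n ?n"
      "A *\<^sub>v col Z 0 = complex_of_real \<sigma> \<cdot>\<^sub>v col W 0" for W A Z
  proof -
    have W: "W \<in> carrier_mat ?n ?n" "mat_adjoint W * W = 1\<^sub>m ?n" using that by (auto simp: unitary_def)
    have aW: "mat_adjoint W \<in> carrier_mat ?n ?n" using W by simp
    have "col (mat_adjoint W * (A * Z)) 0 = mat_adjoint W *\<^sub>v (A *\<^sub>v col Z 0)"
      using col_mult2[OF aW mult_carrier_square[OF that(3,2)], of 0] col_mult2[OF that(3,2), of 0]
      by (simp only: zero_less_Suc)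
    also have "\<dots> = complex_of_real \<sigma> \<cdot>\<^sub>v (mat_adjoint W *\<^sub>v col W 0)"
      unfolding that(4) using W by (intro mult_mat_vec[OF aW] carrier_vecI) auto
    also have "mat_adjoint W *\<^sub>v col W 0 = col (mat_adjoint W * W) 0"
      by (rule col_mult2[symmetric, of _ ?n ?n _ ?n]) (use W aW in auto)
    finally show ?thesis using W by simp
  qed
  have colN: "col N 0 = complex_of_real \<sigma> \<cdot>\<^sub>v unit_vec ?n 0"
    unfolding N_def by (rule first) (use U0 V0 cV Suc.prems Mv in auto)
  have "mat_adjoint N = mat_adjoint (M * V0) * U0"
    unfolding N_def using cU cV Suc.prems by (subst mat_adjoint_mult[of _ ?n ?n _ ?n]) auto
  also have "\<dots> = mat_adjoint V0 * mat_adjoint M * U0"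
    using cU cV Suc.prems by (subst mat_adjoint_mult[of _ ?n ?n _ ?n]) auto
  also have "\<dots> = mat_adjoint V0 * (mat_adjoint M * U0)"
    using cU cV Suc.prems by (intro assoc_mult_mat[of _ ?n ?n _ ?n _ ?n]) auto
  finally have adjN: "mat_adjoint N = mat_adjoint V0 * (mat_adjoint M * U0)" .
  have rowN: "col (mat_adjoint N) 0 = complex_of_real \<sigma> \<cdot>\<^sub>v unit_vec ?n 0"
    unfolding adjN by (rule first) (use U0 V0 cU Suc.prems Mu in auto)
  have Ni0: "N $$ (i, 0) = (if i = 0 then complex_of_real \<sigma> else 0)" if "i < ?n" for i
    using arg_cong[OF colN, of "\<lambda>x. x $ i"] that N by simp
  have N0j: "N $$ (0, j) = (if j = 0 then complex_of_real \<sigma> else 0)" if "j < ?n" for j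
  proof -
    have "cnj (N $$ (0, j)) = (if j = 0 then complex_of_real \<sigma> else 0)"
      using arg_cong[OF rowN, of "\<lambda>x. x $ j"] that N by simp
    hence "cnj (cnj (N $$ (0, j))) = (if j = 0 then complex_of_real \<sigma> else 0)" by (auto split: if_splits)
    thus ?thesis by simp
  qed
  define M' where "M' = mat n n (\<lambda>(i, j). N $$ (Suc i, Suc j))"
  have "M' \<in> carrier_mat n n" by (simp add: M'_def)
  from Suc.IH[OF this] obtain U1 V1 d where IH: "unitary n U1" "unitary n V1" "\<forall>i<n. 0 \<le> d i"
    "M' = U1 * diagm n d * V1" by auto
  have c1: "U1 \<in> carrier_mat n n" "V1 \<in> carrier_mat n n" using IH by (auto simp: unitary_def)
  let ?blk = "\<lambda>W. four_block_mat (1\<^sub>m 1) (0\<^sub>m 1 n) (0\<^sub>m n 1) W"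
  define e where "e i = (case i of 0 \<Rightarrow> \<sigma> | Suc i \<Rightarrow> d i)" for i
  let ?S = "mat 1 1 (\<lambda>_. complex_of_real \<sigma>)"
  have De: "diagm ?n e = four_block_mat ?S (0\<^sub>m 1 n) (0\<^sub>m n 1) (diagm n d)"
    by (rule eq_matI) (auto simp: e_def split: nat.split)
  have "?blk U1 * diagm ?n e = four_block_mat ?S (0\<^sub>m 1 n) (0\<^sub>m n 1) (U1 * diagm n d)"
    unfolding De by (subst mult_four_block_mat[of _ 1 1 _ n _ n _ _ 1 _ n]) (use c1 in auto)
  hence "?blk U1 * diagm ?n e * ?blk V1 = four_block_mat ?S (0\<^sub>m 1 n) (0\<^sub>m n 1) (U1 * diagm n d * V1)"
    by (simp, subst mult_four_block_mat[of _ 1 1 _ n _ n _ _ 1 _ n]) (use c1 in auto)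
  also have "\<dots> = N" unfolding IH(4)[symmetric]
    by (rule eq_matI) (use N Ni0 N0j in \<open>auto simp: M'_def\<close>)
  finally have NB: "N = ?blk U1 * diagm ?n e * ?blk V1" by simp
  have bU: "unitary ?n (?blk U1)" and bV: "unitary ?n (?blk V1)" using IH unitary_block by auto
  note cbU = bU[unfolded unitary_def] and cbV = bV[unfolded unitary_def]
  have "U0 * N * mat_adjoint V0 = M"
  proof -
    have "U0 * N = U0 * mat_adjoint U0 * (M * V0)"
      unfolding N_def using cU cV Suc.prems by (intro assoc_mult_mat[symmetric, of _ ?n ?n _ ?n _ ?n]) auto
    also have "\<dots> = M * V0" using cU cV Suc.prems by auto
    finally have "U0 * N * mat_adjoint V0 = M * (V0 * mat_adjoint V0)"
      using cV Suc.prems by (simp add: assoc_mult_mat[of _ ?n ?n _ ?n _ ?n])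
    thus ?thesis using cV Suc.prems by auto
  qed
  hence "M = (U0 * ?blk U1) * diagm ?n e * (?blk V1 * mat_adjoint V0)"
  proof -
    have "U0 * N = U0 * ?blk U1 * diagm ?n e * ?blk V1"
      unfolding NB using cU cbU cbV by (simp add: assoc_mult_mat[of _ ?n ?n _ ?n _ ?n])
    hence "M = U0 * ?blk U1 * diagm ?n e * ?blk V1 * mat_adjoint V0"
      using \<open>U0 * N * mat_adjoint V0 = M\<close> by simp
    also have "\<dots> = (U0 * ?blk U1) * diagm ?n e * (?blk V1 * mat_adjoint V0)"
      using cU cV cbU cbV by (intro assoc_mult_mat[of _ ?n ?n _ ?n _ ?n]) auto
    finally show ?thesis .
  qed
  moreover have "unitary ?n (U0 * ?blk U1)" "unitary ?n (?blk V1 * mat_adjoint V0)"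
    using unitary_mult U0 V0 bU bV unitary_adjoint by auto
  moreover have "\<forall>i<?n. 0 \<le> e i" using IH(3) uv by (auto simp: e_def split: nat.split)
  ultimately show ?case by blast
qed

lemma udv_index:
  assumes "U \<in> carrier_mat m n" "V \<in> carrier_mat n l" "i < m" "j < l"
  shows "(U * diagm n d * V) $$ (i, j) = (\<Sum>k<n. U $$ (i, k) * complex_of_real (d k) * V $$ (k, j))"
proof -
  have "(U * diagm n d) $$ (i, k) = U $$ (i, k) * complex_of_real (d k)" if "k < n" for k
  proof -
    have "(U * diagm n d) $$ (i, k) = (\<Sum>h<n. if h = k then U $$ (i, h) * complex_of_real (d h) else 0)"
      using assms that by (subst index_mult_mat_sum[of _ m n _ n]) (auto simp: if_distrib cong: if_cong)
    thus ?thesis using that by simp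
  qed
  thus ?thesis using assms
    by (subst index_mult_mat_sum[of _ m n _ l]) (auto intro!: sum.cong mult_carrier_mat simp del: index_mult_mat(1))
qed

lemma unitary_permute_cols:
  assumes U: "unitary n U" and p: "bij_betw p {..<n} {..<n}"
  shows "unitary n (mat n n (\<lambda>(i, j). U $$ (i, p j)))" (is "unitary n ?W")
proof (rule unitary_left_inverse)
  note Uc = U[unfolded unitary_def]
  have pn: "p i < n" if "i < n" for i using p that by (auto simp: bij_betw_def)
  show "mat_adjoint ?W * ?W = 1\<^sub>m n"
  proof (rule eq_matI)
    fix i j assume "i < dim_row (1\<^sub>m n :: complex mat)" "j < dim_col (1\<^sub>m n :: complex mat)"
    hence ij: "i < n" "j < n" by auto
    have "(mat_adjoint ?W * ?W) $$ (i, j) = (\<Sum>k<n. cnj (U $$ (k, p i)) * U $$ (k, p j))"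
      by (subst index_mult_mat_sum[of _ n n _ n]) (use ij in auto)
    also have "\<dots> = (mat_adjoint U * U) $$ (p i, p j)"
      by (subst index_mult_mat_sum[of _ n n _ n]) (use ij Uc pn in auto)
    also have "\<dots> = 1\<^sub>m n $$ (i, j)"
    proof -
      have "p i = p j \<longleftrightarrow> i = j"
        using p ij unfolding bij_betw_def by (meson inj_on_eq_iff lessThan_iff)
      thus ?thesis using ij pn[OF ij(1)] pn[OF ij(2)] Uc by simp
    qed
    finally show "(mat_adjoint ?W * ?W) $$ (i, j) = 1\<^sub>m n $$ (i, j)" .
  qed auto
qed simp

lemma exists_decreasing_permutation:
  fixes d :: "nat \<Rightarrow> real"
  shows "\<exists>p. bij_betw p {..<n} {..<n} \<and> (\<forall>i j. i \<le> j \<longrightarrow> j < n \<longrightarrow> d (p j) \<le> d (p i))"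
proof -
  define xs where "xs = sort_key (\<lambda>i. - d i) [0..<n]"
  have xs: "length xs = n" "set xs = {..<n}" "distinct xs" by (auto simp: xs_def)
  have "sorted (map (\<lambda>i. - d i) xs)" by (simp add: xs_def)
  hence "d (xs ! j) \<le> d (xs ! i)" if "i \<le> j" "j < n" for i j
    using sorted_nth_mono[of "map (\<lambda>i. - d i) xs" i j] that xs by simp
  moreover have "bij_betw ((!) xs) {..<n} {..<n}"
    by (rule bij_betw_nth) (use xs in auto)
  ultimately show ?thesis by (intro exI[of _ "(!) xs"]) auto
qed

text \<open>The right factor is \<open>V\<close> itself and not an adjoint, since the correcting
  unitary of Bob will be its transpose. The order belongs to the notion so that the squares list the
  Schmidt vector and sums of several such lists stay decreasing.\<close>

definition is_svd :: "nat \<Rightarrow> complex mat \<Rightarrow> complex mat \<Rightarrow> (nat \<Rightarrow> real) \<Rightarrow> complex mat \<Rightarrow> bool" where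
  "is_svd n M U d V \<longleftrightarrow> unitary n U \<and> unitary n V \<and> (\<forall>i<n. 0 \<le> d i) \<and>
     (\<forall>i j. i \<le> j \<longrightarrow> j < n \<longrightarrow> d j \<le> d i) \<and> M = U * diagm n d * V"

lemma svd_exists:
  assumes "M \<in> carrier_mat n n"
  shows "\<exists>U d V. is_svd n M U d V"
proof -
  obtain U V d where s: "unitary n U" "unitary n V" "\<forall>i<n. 0 \<le> d i" "M = U * diagm n d * V"
    using svd_unsorted[OF assms] by auto
  obtain p where p: "bij_betw p {..<n} {..<n}" "\<forall>i j. i \<le> j \<longrightarrow> j < n \<longrightarrow> d (p j) \<le> d (p i)"
    using exists_decreasing_permutation by blast
  have pn: "p i < n" if "i < n" for i using p that by (auto simp: bij_betw_def)
  have c: "U \<in> carrier_mat n n" "V \<in> carrier_mat n n" using s by (auto simp: unitary_def)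
  define U' where "U' = mat n n (\<lambda>(i, j). U $$ (i, p j))"
  \<comment> \<open>The rows of V must move along with the columns of U; transposing reduces this to
    permuting columns.\<close>
  define V' where "V' = (mat n n (\<lambda>(i, j). V\<^sup>T $$ (i, p j)))\<^sup>T"
  have U': "unitary n U'" unfolding U'_def by (rule unitary_permute_cols[OF s(1) p(1)])
  have V': "unitary n V'" unfolding V'_def
    by (intro unitary_transpose unitary_permute_cols[OF _ p(1)] s)
  have "U * diagm n d * V = U' * diagm n (d \<circ> p) * V'"
  proof (rule eq_matI)
    fix i j assume "i < dim_row (U' * diagm n (d \<circ> p) * V')" "j < dim_col (U' * diagm n (d \<circ> p) * V')"
    hence ij: "i < n" "j < n" by (auto simp: U'_def V'_def)
    have "(U * diagm n d * V) $$ (i, j) = (\<Sum>k<n. U $$ (i, k) * complex_of_real (d k) * V $$ (k, j))"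
      by (rule udv_index[OF c ij])
    also have "\<dots> = (\<Sum>k<n. U $$ (i, p k) * complex_of_real (d (p k)) * V $$ (p k, j))"
      by (rule sum.reindex_bij_betw[OF p(1), symmetric])
    also have "\<dots> = (U' * diagm n (d \<circ> p) * V') $$ (i, j)"
      by (subst udv_index[of _ n _ _ n]) (use ij pn c in \<open>auto simp: U'_def V'_def\<close>)
    finally show "(U * diagm n d * V) $$ (i, j) = (U' * diagm n (d \<circ> p) * V') $$ (i, j)" .
  qed (use c in \<open>auto simp: U'_def V'_def\<close>)
  thus ?thesis using U' V' s p pn unfolding is_svd_def
    by (intro exI[of _ U'] exI[of _ "d \<circ> p"] exI[of _ V']) auto
qed

subsection \<open>Schmidt vectors and singular values\<close>

text \<open>Rows belong to Alice and columns to Bob, so local operators act by multiplication on the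
  two sides and Schmidt rank is matrix rank.\<close>

definition reshape :: "nat \<Rightarrow> nat \<Rightarrow> complex vec \<Rightarrow> complex mat" where
  "reshape a b v = mat a b (\<lambda>(i, j). v $ (i * b + j))"

lemma reshape_carrier [simp]: "reshape a b v \<in> carrier_mat a b"
  and reshape_dim [simp]: "dim_row (reshape a b v) = a" "dim_col (reshape a b v) = b"
  and reshape_index [simp]: "i < a \<Longrightarrow> j < b \<Longrightarrow> reshape a b v $$ (i, j) = v $ (i * b + j)"
  by (auto simp: reshape_def)

lemma block_index_less: "(i::nat) < a \<Longrightarrow> j < b \<Longrightarrow> i * b + j < a * b"
proof -
  assume "i < a" "j < b"
  hence "i * b + j < Suc i * b" by simp
  also have "\<dots> \<le> a * b" using \<open>i < a\<close> by (intro mult_le_mono1) simp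
  finally show ?thesis .
qed

lemma adjoint_diagm [simp]: "mat_adjoint (diagm n d) = diagm n d"
  by (rule eq_matI) auto

lemma diagm_mult: "diagm n d * diagm n e = diagm n (\<lambda>i. d i * e i)"
proof (rule eq_matI)
  fix i j assume "i < dim_row (diagm n (\<lambda>i. d i * e i))" "j < dim_col (diagm n (\<lambda>i. d i * e i))"
  hence ij: "i < n" "j < n" by auto
  have "(diagm n d * diagm n e) $$ (i, j) =
    (\<Sum>k<n. if k = i then diagm n d $$ (i, k) * diagm n e $$ (k, j) else 0)"
    by (subst index_mult_mat_sum[of _ n n _ n]) (use ij in \<open>auto intro: sum.cong simp del: sum.delta\<close>)
  thus "(diagm n d * diagm n e) $$ (i, j) = diagm n (\<lambda>i. d i * e i) $$ (i, j)" using ij by simp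
qed auto

text \<open>Tracing out Alice leaves the index of Bob, which is the column index; hence the
  transpose.\<close>

lemma partial_trace_projector:
  assumes v: "v \<in> carrier_vec (n * n)"
  shows "partial_trace_A n n (projector v) = (reshape n n v)\<^sup>T * mat_adjoint ((reshape n n v)\<^sup>T)"
proof (rule eq_matI)
  let ?M = "reshape n n v"
  fix i j assume "i < dim_row (?M\<^sup>T * mat_adjoint (?M\<^sup>T))" "j < dim_col (?M\<^sup>T * mat_adjoint (?M\<^sup>T))"
  hence ij: "i < n" "j < n" by auto
  show "partial_trace_A n n (projector v) $$ (i, j) = (?M\<^sup>T * mat_adjoint (?M\<^sup>T)) $$ (i, j)"
    by (subst index_mult_mat_sum[of _ n n _ n])
      (use ij v in \<open>auto simp: partial_trace_A_def projector_def block_index_less intro!: sum.cong\<close>)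
qed (auto simp: partial_trace_A_def)

lemma proots_prod_linear:
  "proots (\<Prod>a\<leftarrow>xs. [:- (a::complex), 1:]) = mset xs"
proof (induction xs)
  case (Cons a xs)
  have "(\<Prod>a\<leftarrow>xs. [:- a, 1:]) \<noteq> (0 :: complex poly)" by (auto simp: prod_list_zero_iff)
  thus ?case using Cons proots_mult[of "[:- a, 1:]" "\<Prod>a\<leftarrow>xs. [:- a, 1:]"] by simp
qed simp

text \<open>If the matrix of v is U D V, then U cancels in the reduced operator, and
  \<open>V\<^sup>T\<close> diagonalises it to the square of D. So its characteristic polynomial has
  the roots \<open>(d i)\<^sup>2\<close>, with multiplicity.\<close>

lemma schmidt_vector_svd:
  assumes v: "v \<in> carrier_vec (n * n)" and svd: "is_svd n (reshape n n v) U d V"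
  shows "schmidt_vector n v = map (\<lambda>i. (d i)\<^sup>2) [0..<n]"
proof -
  note s = svd[unfolded is_svd_def]
  define A B where "A = V\<^sup>T" and "B = U\<^sup>T"
  have uA: "unitary n A" "unitary n B" using s unitary_transpose by (auto simp: A_def B_def)
  note cA = uA(1)[unfolded unitary_def] and cB = uA(2)[unfolded unitary_def]
  have cc: "U \<in> carrier_mat n n" "V \<in> carrier_mat n n" using s by (auto simp: unitary_def)
  let ?D = "diagm n d" and ?M = "reshape n n v"
  have DT: "?D\<^sup>T = ?D" by (rule eq_matI) auto
  have "?M\<^sup>T = A * (?D * B)"
    using s cc transpose_mult[of "U * ?D" n n V n] transpose_mult[of U n n ?D n] by (simp add: A_def B_def DT)
  also have "\<dots> = A * ?D * B" using cA cB by (intro assoc_mult_mat[symmetric, of _ n n _ n _ n]) auto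
  finally have MT: "?M\<^sup>T = A * ?D * B" .
  have aMT: "mat_adjoint (?M\<^sup>T) = mat_adjoint B * (?D * mat_adjoint A)"
    unfolding MT using cA cB
    by (subst mat_adjoint_mult[of _ n n _ n]) (auto intro!: mult_carrier_mat simp: mat_adjoint_mult[of _ n n _ n])
  have "?M\<^sup>T * mat_adjoint (?M\<^sup>T) = A * ?D * (B * (mat_adjoint B * (?D * mat_adjoint A)))"
    unfolding aMT unfolding MT using cA cB
    by (intro assoc_mult_mat[of _ n n _ n _ n]) (auto intro!: mult_carrier_mat)
  also have "B * (mat_adjoint B * (?D * mat_adjoint A)) = B * mat_adjoint B * (?D * mat_adjoint A)"
    using cA cB by (intro assoc_mult_mat[symmetric, of _ n n _ n _ n]) (auto intro!: mult_carrier_mat)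
  also have "\<dots> = ?D * mat_adjoint A" using cA cB by auto
  also have "A * ?D * (?D * mat_adjoint A) = A * ?D * ?D * mat_adjoint A"
    using cA cB by (intro assoc_mult_mat[symmetric, of _ n n _ n _ n]) (auto intro!: mult_carrier_mat)
  also have "A * ?D * ?D = A * (?D * ?D)"
    using cA cB by (intro assoc_mult_mat[of _ n n _ n _ n]) (auto intro!: mult_carrier_mat)
  finally have pt: "partial_trace_A n n (projector v) = A * diagm n (\<lambda>i. (d i)\<^sup>2) * mat_adjoint A" (is "?P = A * ?E * _")
    using partial_trace_projector[OF v] by (simp add: diagm_mult power2_eq_square)
  have "similar_mat_wit ?P ?E A (mat_adjoint A)"
    unfolding similar_mat_wit_def Let_def using pt cA
    by (auto simp: partial_trace_A_def)
  hence "char_poly ?P = char_poly ?E"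
    by (intro char_poly_similar) (auto simp: similar_mat_def)
  also have "\<dots> = (\<Prod>a\<leftarrow>diag_mat ?E. [:- a, 1:])"
    by (rule char_poly_upper_triangular[of _ n]) auto
  finally have "proots (char_poly ?P) = mset (diag_mat ?E)" by (simp only: proots_prod_linear)
  also have "diag_mat ?E = map (\<lambda>i. complex_of_real ((d i)\<^sup>2)) [0..<n]"
    by (auto simp: diag_mat_def)
  finally have "image_mset Re (proots (char_poly ?P)) = mset (map (\<lambda>i. (d i)\<^sup>2) [0..<n])"
    by (simp add: image_mset.compositionality comp_def del: mset_upt)
  hence sv: "schmidt_vector n v = rev (sort (map (\<lambda>i. (d i)\<^sup>2) [0..<n]))"
    by (simp only: schmidt_vector_def sorted_list_of_multiset_mset)
  \<comment> \<open>Squaring keeps the decreasing order because the \<open>d i\<close> are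
    nonnegative, so sorting and reversing give the list back.\<close>
  have "sorted (rev (map (\<lambda>i. (d i)\<^sup>2) [0..<n]))"
    using s by (auto simp: sorted_rev_iff_nth_mono intro!: power_mono)
  hence "sort (map (\<lambda>i. (d i)\<^sup>2) [0..<n]) = rev (map (\<lambda>i. (d i)\<^sup>2) [0..<n])"
    by (intro properties_for_sort) auto
  thus ?thesis using sv by simp
qed

subsection \<open>Best approximation by matrices of low rank\<close>

text \<open>Rank as factorization through dimension k: visibly stable under multiplication on either
  side, and it supplies k columns whose span contains the range.\<close>

definition rank_le :: "nat \<Rightarrow> complex mat \<Rightarrow> bool" where
  "rank_le k N \<longleftrightarrow> (\<exists>X Y. X \<in> carrier_mat (dim_row N) k \<and> Y \<in> carrier_mat k (dim_col N) \<and> N = X * Y)"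

lemma rank_le_mult:
  assumes "rank_le k N" "N \<in> carrier_mat a b" "A \<in> carrier_mat c a" "B \<in> carrier_mat b d"
  shows "rank_le k (A * N * B)"
proof -
  obtain X Y where XY: "X \<in> carrier_mat a k" "Y \<in> carrier_mat k b" "N = X * Y"
    using assms by (auto simp: rank_le_def)
  have "A * N * B = A * X * Y * B" using XY assms by (simp add: assoc_mult_mat[of _ c a _ k _ b])
  also have "\<dots> = (A * X) * (Y * B)" using XY assms by (intro assoc_mult_mat[of _ c k _ b _ d]) auto
  finally show ?thesis unfolding rank_le_def using XY assms
    by (intro exI[of _ "A * X"] exI[of _ "Y * B"]) auto
qed

lemma fro_diagm: "fro (diagm n d) = (\<Sum>i<n. (d i)\<^sup>2)"
proof -
  have "fro (diagm n d) = (\<Sum>i<n. \<Sum>j<n. if i = j then (d i)\<^sup>2 else 0)"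
    unfolding fro_def by (intro sum.cong) auto
  thus ?thesis by simp
qed

lemma fro_svd: 
  assumes "is_svd n M U d V" shows "fro M = (\<Sum>i<n. (d i)\<^sup>2)"
proof -
  note s = assms[unfolded is_svd_def]
  have "U \<in> carrier_mat n n" using s by (auto simp: unitary_def)
  hence "fro (U * diagm n d * V) = fro (diagm n d)"
    using s by (simp add: fro_unitary_right[of n _ _ n] fro_mult_unitary[of n _ _ n] mult_carrier_mat[of _ n n])
  thus ?thesis using s fro_diagm by simp
qed

text \<open>Keep the first k singular values; the error has the same outer unitaries, with the
  remaining values on its diagonal.\<close>

lemma truncated_svd:
  assumes "is_svd n M U d V" "k \<le> n"
  shows "\<exists>N. N \<in> carrier_mat n n \<and> rank_le k N \<and> fro (M - N) = (\<Sum>i=k..<n. (d i)\<^sup>2)"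
proof -
  note s = assms(1)[unfolded is_svd_def]
  have c: "U \<in> carrier_mat n n" "V \<in> carrier_mat n n" using s by (auto simp: unitary_def)
  define X where "X = mat n k (\<lambda>(i, l). U $$ (i, l) * complex_of_real (d l))"
  define Y where "Y = mat k n (\<lambda>(l, j). V $$ (l, j))"
  let ?e = "\<lambda>i. if i < k then 0 else d i"
  have "M - X * Y = U * diagm n ?e * V"
  proof (rule eq_matI)
    fix i j assume "i < dim_row (U * diagm n ?e * V)" "j < dim_col (U * diagm n ?e * V)"
    hence ij: "i < n" "j < n" using c by auto
    have "(X * Y) $$ (i, j) = (\<Sum>l<k. U $$ (i, l) * complex_of_real (d l) * V $$ (l, j))"
      by (subst index_mult_mat_sum[of _ n k _ n]) (use ij in \<open>auto simp: X_def Y_def\<close>)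
    moreover have "M $$ (i, j) = (\<Sum>l<n. U $$ (i, l) * complex_of_real (d l) * V $$ (l, j))"
      using s udv_index[OF c ij] by simp
    moreover have "(\<Sum>l<n. U $$ (i, l) * complex_of_real (d l) * V $$ (l, j)) =
      (\<Sum>l<k. U $$ (i, l) * complex_of_real (d l) * V $$ (l, j)) +
      (\<Sum>l=k..<n. U $$ (i, l) * complex_of_real (d l) * V $$ (l, j))"
      using assms(2) by (subst sum.union_disjoint[symmetric]) (auto intro!: sum.cong)
    moreover have "(U * diagm n ?e * V) $$ (i, j) = (\<Sum>l=k..<n. U $$ (i, l) * complex_of_real (d l) * V $$ (l, j))"
      unfolding udv_index[OF c ij] by (rule sum.mono_neutral_cong_right) auto
    ultimately show "(M - X * Y) $$ (i, j) = (U * diagm n ?e * V) $$ (i, j)"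
      using ij by (simp add: X_def Y_def del: index_mult_mat(1))
  qed (use c in \<open>auto simp: X_def Y_def\<close>)
  moreover have "fro (U * diagm n ?e * V) = (\<Sum>i<n. (?e i)\<^sup>2)"
    using s c by (simp add: fro_unitary_right[of n _ _ n] fro_mult_unitary[of n _ _ n] mult_carrier_mat[of _ n n] fro_diagm)
  moreover have "(\<Sum>i<n. (?e i)\<^sup>2) = (\<Sum>i=k..<n. (d i)\<^sup>2)"
    by (rule sum.mono_neutral_cong_right) auto
  ultimately have "fro (M - X * Y) = (\<Sum>i=k..<n. (d i)\<^sup>2)" by simp
  moreover have "rank_le k (X * Y)" unfolding rank_le_def
    by (rule exI[of _ X], rule exI[of _ Y]) (auto simp: X_def Y_def)
  moreover have "X * Y \<in> carrier_mat n n"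
    by (rule mult_carrier_mat[of _ n k]) (auto simp: X_def Y_def)
  ultimately show ?thesis by blast
qed

text \<open>Total weight n - k, at most 1 per position, is cheapest on the n - k smallest values.
  The threshold \<open>e k\<close> separates the two groups, and the weight on the first k positions
  equals what the others lack from full weight.\<close>

lemma weighted_tail_bound:
  fixes e p :: "nat \<Rightarrow> real"
  assumes dec: "\<And>i j. i \<le> j \<Longrightarrow> j < n \<Longrightarrow> e j \<le> e i" and p: "\<And>j. j < n \<Longrightarrow> 0 \<le> p j \<and> p j \<le> 1"
    and sum: "(\<Sum>j<n. p j) = real (n - k)" and k: "k \<le> n"
  shows "(\<Sum>j=k..<n. e j) \<le> (\<Sum>j<n. e j * p j)"
\<comment> \<open>For k = n the threshold \<open>e k\<close> lies outside the range on which
  \<open>e\<close> is known to decrease; there all weights vanish.\<close>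
proof (cases "k < n")
  case True
  have split: "(\<Sum>j<n. f j) = (\<Sum>j<k. f j) + (\<Sum>j=k..<n. f j)" for f :: "nat \<Rightarrow> real"
    using k by (subst sum.union_disjoint[symmetric]) (auto intro!: sum.cong)
  have "(\<Sum>j<k. e k * p j) \<le> (\<Sum>j<k. e j * p j)"
    using p True dec by (intro sum_mono mult_right_mono) auto
  moreover have "(\<Sum>j=k..<n. e j * (1 - p j)) \<le> (\<Sum>j=k..<n. e k * (1 - p j))"
    using p True dec by (intro sum_mono mult_right_mono) auto
  moreover have "(\<Sum>j=k..<n. e j * (1 - p j)) = (\<Sum>j=k..<n. e j) - (\<Sum>j=k..<n. e j * p j)"
    by (simp add: algebra_simps sum_subtractf)
  moreover have "(\<Sum>j=k..<n. e k * (1 - p j)) = e k * (real (n - k) - (\<Sum>j=k..<n. p j))"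
    by (simp add: algebra_simps sum_subtractf sum_distrib_left)
  moreover have "(\<Sum>j<k. e k * p j) = e k * (\<Sum>j<k. p j)" by (simp add: sum_distrib_left)
  moreover have "real (n - k) - (\<Sum>j=k..<n. p j) = (\<Sum>j<k. p j)" using split[of p] sum by simp
  ultimately show ?thesis using split[of "\<lambda>j. e j * p j"] by simp
next
  case False
  have "(\<Sum>j<n. p j) = 0" using sum False by simp
  hence "\<forall>j<n. p j = 0" using p by (subst (asm) sum_nonneg_eq_0_iff) auto
  thus ?thesis using False by simp
qed

text \<open>Project the error onto n - k orthonormal directions orthogonal to the range of N. This
  removes N and leaves a weighted sum of the squares of \<open>d\<close>, with weights as in
  \<open>weighted_tail_bound\<close>; projecting cannot increase the norm.\<close>

lemma eckart_young_diag:
  assumes dec: "\<And>i j. i \<le> j \<Longrightarrow> j < n \<Longrightarrow> d j \<le> d i" and nn: "\<And>i. i < n \<Longrightarrow> 0 \<le> d i"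
    and N: "N \<in> carrier_mat n n" "rank_le k N" and k: "k \<le> n"
  shows "(\<Sum>i=k..<n. (d i)\<^sup>2) \<le> fro (diagm n d - N)"
proof -
  obtain X Y where XY: "X \<in> carrier_mat n k" "Y \<in> carrier_mat k n" "N = X * Y"
    using N by (auto simp: rank_le_def)
  obtain z where z: "orthonormal n (n - k) z" "\<forall>l<k. \<forall>i<n - k. col X l \<bullet>c z i = 0"
    using orthonormal_complement[of k "col X" n "n - k"] XY k by auto
  \<comment> \<open>The first n - k columns are the directions orthogonal to the range of N; the
    others only complete a unitary.\<close>
  obtain Z where Z: "unitary n Z" "\<forall>j<n - k. col Z j = z j"
    using unitary_with_first_columns[OF z(1)] by auto
  have Zc: "Z \<in> carrier_mat n n" using Z by (auto simp: unitary_def)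
  have zc: "z i \<in> carrier_vec n" if "i < n - k" for i using z that by (simp add: orthonormal_def)
  have Zz: "Z $$ (l, i) = z i $ l" if "i < n - k" "l < n" for i l
    using arg_cong[OF Z(2)[rule_format, OF that(1)], of "\<lambda>x. x $ l"] Zc that by simp
  let ?aZ = "mat_adjoint Z" and ?D = "diagm n d"
  have aZ: "?aZ \<in> carrier_mat n n" using Zc by simp
  have entry: "(?aZ * (?D - N)) $$ (i, j) = cnj (Z $$ (j, i)) * complex_of_real (d j)"
    if i: "i < n - k" and j: "j < n" for i j
  proof -
    have N0: "(\<Sum>l<n. cnj (Z $$ (l, i)) * N $$ (l, j)) = 0"
    proof -
      have "(\<Sum>l<n. cnj (Z $$ (l, i)) * N $$ (l, j)) = (\<Sum>l<n. \<Sum>h<k. cnj (z i $ l) * X $$ (l, h) * Y $$ (h, j))"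
        using i j XY Zz by (simp add: index_mult_mat_sum[of _ n k _ n] sum_distrib_left mult_ac del: index_mult_mat(1))
      also have "\<dots> = (\<Sum>h<k. (col X h \<bullet>c z i) * Y $$ (h, j))"
        using i XY zc by (subst sum.swap) (simp add: cscalar_prod_sum[of _ n] sum_distrib_left sum_distrib_right mult_ac)
      also have "\<dots> = 0" using z(2) i by simp
      finally show ?thesis .
    qed
    have "(?aZ * (?D - N)) $$ (i, j) = (\<Sum>l<n. cnj (Z $$ (l, i)) * (?D $$ (l, j) - N $$ (l, j)))"
      by (subst index_mult_mat_sum[of _ n n _ n]) (use i j Zc N in auto)
    also have "\<dots> = (\<Sum>l<n. cnj (Z $$ (l, i)) * ?D $$ (l, j))"
      using N0 by (simp add: right_diff_distrib sum_subtractf)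
    also have "\<dots> = (\<Sum>l<n. if l = j then cnj (Z $$ (l, i)) * complex_of_real (d l) else 0)"
      using j by (intro sum.cong) auto
    finally show ?thesis using j by simp
  qed
  \<comment> \<open>The weight of coordinate j in the first n - k columns of Z: at most 1 because
    the rows of Z are unit vectors, and n - k in total because the columns are.\<close>
  define p where "p j = (\<Sum>i<n - k. (cmod (Z $$ (j, i)))\<^sup>2)" for j
  have rowsum: "(\<Sum>i<n. (cmod (Z $$ (j, i)))\<^sup>2) = 1" if "j < n" for j
  proof -
    have "complex_of_real (\<Sum>i<n. (cmod (Z $$ (j, i)))\<^sup>2) = (Z * ?aZ) $$ (j, j)"
      by (subst index_mult_mat_sum[of _ n n _ n]) (use that Zc in \<open>auto simp: cmod_square mult.commute\<close>)
    thus ?thesis using Z that by (simp add: unitary_def del: of_real_sum)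
  qed
  have "p j \<le> 1" if "j < n" for j
    unfolding rowsum[OF that, symmetric] p_def by (rule sum_mono2) auto
  moreover have "(\<Sum>j<n. p j) = real (n - k)"
  proof -
    have "complex_of_real (\<Sum>j<n. (cmod (Z $$ (j, i)))\<^sup>2) = (?aZ * Z) $$ (i, i)" if "i < n" for i
      by (subst index_mult_mat_sum[of _ n n _ n]) (use that Zc in \<open>auto simp: cmod_square\<close>)
    hence "(\<Sum>j<n. (cmod (Z $$ (j, i)))\<^sup>2) = 1" if "i < n" for i
      using that Z by (simp add: unitary_def del: of_real_sum)
    thus ?thesis unfolding p_def by (subst sum.swap) simp
  qed
  ultimately have "(\<Sum>j=k..<n. (d j)\<^sup>2) \<le> (\<Sum>j<n. (d j)\<^sup>2 * p j)"
    using dec nn k by (intro weighted_tail_bound) (auto simp: p_def sum_nonneg intro!: power_mono)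
  also have "\<dots> = (\<Sum>i<n - k. \<Sum>j<n. (cmod ((?aZ * (?D - N)) $$ (i, j)))\<^sup>2)"
    unfolding p_def sum_distrib_left by (subst sum.swap)
      (auto simp: entry norm_mult power_mult_distrib mult.commute intro!: sum.cong simp del: index_mult_mat(1))
  also have "\<dots> \<le> fro (?aZ * (?D - N))"
    unfolding fro_def using Zc N by (auto intro!: sum_mono2 sum_nonneg simp del: index_mult_mat(1))
  also have "\<dots> = fro (?D - N)"
    by (rule fro_mult_unitary[of n _ _ n]) (use Z unitary_adjoint N in auto)
  finally show ?thesis .
qed

text \<open>The Frobenius norm and the rank bound survive unitary factors on both sides, so M may be
  replaced by its diagonal.\<close>

lemma eckart_young:
  assumes svd: "is_svd n M U d V" and N: "N \<in> carrier_mat n n" "rank_le k N" and k: "k \<le> n"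
  shows "(\<Sum>i=k..<n. (d i)\<^sup>2) \<le> fro (M - N)"
proof -
  note s = svd[unfolded is_svd_def]
  have c: "U \<in> carrier_mat n n" "V \<in> carrier_mat n n" "mat_adjoint U \<in> carrier_mat n n" "mat_adjoint V \<in> carrier_mat n n"
    using s by (auto simp: unitary_def)
  define N' where "N' = mat_adjoint U * N * mat_adjoint V"
  have N': "N' \<in> carrier_mat n n" "rank_le k N'"
    unfolding N'_def by (auto intro!: mult_carrier_square rank_le_mult[OF N(2,1)] c N)
  have "mat_adjoint U * M * mat_adjoint V = diagm n d"
  proof -
    have "mat_adjoint U * (U * diagm n d * V) = mat_adjoint U * (U * (diagm n d * V))"
      using c by (simp add: assoc_mult_mat[of _ n n _ n _ n])
    also have "\<dots> = mat_adjoint U * U * (diagm n d * V)"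
      using c by (intro assoc_mult_mat[symmetric, of _ n n _ n _ n]) (auto intro!: mult_carrier_mat)
    also have "\<dots> = diagm n d * V" using s c by (auto simp: unitary_def)
    finally have "mat_adjoint U * M * mat_adjoint V = diagm n d * V * mat_adjoint V" using s by simp
    also have "\<dots> = diagm n d * (V * mat_adjoint V)" using c by (intro assoc_mult_mat[of _ n n _ n _ n]) auto
    also have "\<dots> = diagm n d" using s by (auto simp: unitary_def)
    finally show ?thesis .
  qed
  moreover have Mc: "M \<in> carrier_mat n n" using s c by (auto intro!: mult_carrier_mat)
  moreover have "mat_adjoint U * (M - N) * mat_adjoint V =
      mat_adjoint U * M * mat_adjoint V - mat_adjoint U * N * mat_adjoint V"
    unfolding mult_minus_distrib_mat[OF c(3) Mc N(1)]
    by (rule minus_mult_distrib_mat[of _ n n]) (use c Mc N in auto)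
  ultimately have "diagm n d - N' = mat_adjoint U * (M - N) * mat_adjoint V"
    unfolding N'_def by metis
  moreover have "fro (mat_adjoint U * (M - N) * mat_adjoint V) = fro (M - N)"
    using s c N Mc unitary_adjoint
    by (simp add: fro_unitary_right[of n _ _ n] fro_mult_unitary[of n _ _ n] mult_carrier_mat[of _ n n] minus_carrier_mat)
  moreover have "(\<Sum>i=k..<n. (d i)\<^sup>2) \<le> fro (diagm n d - N')"
    using s N' k by (intro eckart_young_diag) auto
  ultimately show ?thesis by simp
qed

subsection \<open>LOCC operations are separable\<close>

lemma sum_block_index:
  fixes f :: "nat \<Rightarrow> 'a :: comm_monoid_add"
  shows "(\<Sum>t<a * b. f t) = (\<Sum>i<a. \<Sum>j<b. f (i * b + j))"
proof -
  have "sum f {i * b..<i * b + b} = (\<Sum>j<b. f (i * b + j))" for i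
    using sum.shift_bounds_nat_ivl[of f 0 "i * b" b] by (simp add: atLeast0LessThan add.commute)
  thus ?thesis by (simp add: sum.nat_group[symmetric])
qed

lemma vnorm2_reshape: 
  assumes "v \<in> carrier_vec (a * b)" shows "vnorm2 v = fro (reshape a b v)"
  using assms by (simp add: vnorm2_def fro_def sum_block_index)

lemma tensor_carrier:
  "A \<in> carrier_mat c a \<Longrightarrow> B \<in> carrier_mat d b \<Longrightarrow> tensor A B \<in> carrier_mat (c * d) (a * b)"
  by (auto simp: tensor_def)

lemma reshape_tensor:
  assumes A: "A \<in> carrier_mat c a" and B: "B \<in> carrier_mat d b" and v: "v \<in> carrier_vec (a * b)"
  shows "reshape c d (tensor A B *\<^sub>v v) = A * reshape a b v * B\<^sup>T"
proof (rule eq_matI)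
  fix i j assume "i < dim_row (A * reshape a b v * B\<^sup>T)" "j < dim_col (A * reshape a b v * B\<^sup>T)"
  hence ij: "i < c" "j < d" using A B by auto
  have AR: "A * reshape a b v \<in> carrier_mat c b" using A by (intro mult_carrier_mat[of _ c a]) auto
  have "reshape c d (tensor A B *\<^sub>v v) $$ (i, j) = (\<Sum>t<a * b. tensor A B $$ (i * d + j, t) * v $ t)"
    using ij index_mult_mat_vec_sum[OF tensor_carrier[OF A B] v block_index_less[OF ij]]
    by (simp del: index_mult_mat_vec)
  also have "\<dots> = (\<Sum>p<a. \<Sum>q<b. A $$ (i, p) * B $$ (j, q) * v $ (p * b + q))"
    unfolding sum_block_index using A B ij block_index_less
    by (intro sum.cong refl) (auto simp: tensor_def)
  also have "\<dots> = (\<Sum>q<b. \<Sum>p<a. A $$ (i, p) * B $$ (j, q) * v $ (p * b + q))" by (rule sum.swap)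
  also have "\<dots> = (A * reshape a b v * B\<^sup>T) $$ (i, j)"
    using ij B by (simp add: index_mult_mat_sum[OF AR, of _ d] index_mult_mat_sum[OF A, of _ b]
        sum_distrib_right sum_distrib_left mult_ac del: index_mult_mat(1))
  finally show "reshape c d (tensor A B *\<^sub>v v) $$ (i, j) = (A * reshape a b v * B\<^sup>T) $$ (i, j)" .
qed (use A B in auto)

text \<open>The one property of product operators that monotonicity uses. It passes to composites at
  once, with no identity for products of tensors.\<close>

definition local_op :: "nat \<Rightarrow> nat \<Rightarrow> nat \<Rightarrow> nat \<Rightarrow> complex mat \<Rightarrow> bool" where
  "local_op a b c d X \<longleftrightarrow> X \<in> carrier_mat (c * d) (a * b) \<and>
     (\<forall>k. \<forall>v \<in> carrier_vec (a * b). rank_le k (reshape a b v) \<longrightarrow> rank_le k (reshape c d (X *\<^sub>v v)))"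

lemma local_op_tensor:
  assumes "A \<in> carrier_mat c a" "B \<in> carrier_mat d b"
  shows "local_op a b c d (tensor A B)"
  unfolding local_op_def
  using assms by (auto simp: reshape_tensor[OF assms] tensor_carrier intro!: rank_le_mult[of _ _ a b])

lemma local_op_mult:
  assumes "local_op a b a' b' T" "local_op a' b' c d X"
  shows "local_op a b c d (X * T)"
proof -
  have c: "X \<in> carrier_mat (c * d) (a' * b')" "T \<in> carrier_mat (a' * b') (a * b)"
    using assms by (auto simp: local_op_def)
  have "(X * T) *\<^sub>v v = X *\<^sub>v (T *\<^sub>v v)" if "v \<in> carrier_vec (a * b)" for v
    using assoc_mult_mat_vec[OF c that] .
  moreover have "T *\<^sub>v v \<in> carrier_vec (a' * b')" if "v \<in> carrier_vec (a * b)" for v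
    using mult_mat_vec_carrier[OF c(2) that] .
  ultimately show ?thesis using assms c mult_carrier_mat[OF c] by (auto simp: local_op_def)
qed

text \<open>Sums over lists, because unfolding a protocol concatenates the Kraus operators of
  branches, whose number depends on the outcome.\<close>

definition msum :: "nat \<Rightarrow> complex mat list \<Rightarrow> complex mat" where
  "msum d Xs = mat d d (\<lambda>(r, c). \<Sum>X\<leftarrow>Xs. X $$ (r, c))"

lemma msum_carrier [simp]: "msum d Xs \<in> carrier_mat d d"
  by (simp add: msum_def)

lemma mat_sum_msum: "mat_sum d m f = msum d (map f [0..<m])"
  unfolding mat_sum_def msum_def
  by (rule eq_matI) (auto simp: interv_sum_list_conv_sum_set_nat atLeast0LessThan comp_def)

lemma sum_list_concat_map:
  "(\<Sum>x\<leftarrow>concat xss. f x :: 'b :: comm_monoid_add) = (\<Sum>xs\<leftarrow>xss. \<Sum>x\<leftarrow>xs. f x)"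
  by (induction xss) auto

lemma sum_list_upt: "(\<Sum>j\<leftarrow>[0..<k]. f j) = (\<Sum>j<k. f j :: 'a :: comm_monoid_add)"
  by (simp add: interv_sum_list_conv_sum_set_nat atLeast0LessThan)

lemma sum_list_swap:
  "(\<Sum>x\<leftarrow>xs. \<Sum>y\<leftarrow>ys. f x y :: 'c :: comm_monoid_add) = (\<Sum>y\<leftarrow>ys. \<Sum>x\<leftarrow>xs. f x y)"
  by (induction xs) (auto simp: sum_list_addf)

lemma msum_concat: "msum d (concat Yss) = msum d (map (msum d) Yss)"
proof (rule eq_matI)
  fix i j assume "i < dim_row (msum d (map (msum d) Yss))" "j < dim_col (msum d (map (msum d) Yss))"
  hence "i < d" "j < d" by (auto simp: msum_def)
  thus "msum d (concat Yss) $$ (i, j) = msum d (map (msum d) Yss) $$ (i, j)"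
    by (simp add: msum_def comp_def sum_list_concat_map del: map_concat)
qed (auto simp: msum_def)

lemma msum_Cons: "Y \<in> carrier_mat d d \<Longrightarrow> msum d (Y # Ys) = Y + msum d Ys"
  by (rule eq_matI) (auto simp: msum_def)

lemma msum_singleton: "Y \<in> carrier_mat d d \<Longrightarrow> msum d [Y] = Y"
  by (rule eq_matI) (auto simp: msum_def)

lemma conjugate_msum:
  assumes X: "X \<in> carrier_mat c a" and Ys: "\<forall>Y \<in> set Ys. Y \<in> carrier_mat a a"
  shows "X * msum a Ys * mat_adjoint X = msum c (map (\<lambda>Y. X * Y * mat_adjoint X) Ys)"
  using Ys
proof (induction Ys)
  case Nil
  have "msum a [] = 0\<^sub>m a a" "msum c [] = 0\<^sub>m c c" by (auto simp: msum_def)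
  thus ?case using X by simp
next
  case (Cons Y Ys)
  have Y: "Y \<in> carrier_mat a a" and aX: "mat_adjoint X \<in> carrier_mat a c" using Cons X by auto
  have XY: "X * Y \<in> carrier_mat c a" "X * msum a Ys \<in> carrier_mat c a"
    using X Y by (auto intro!: mult_carrier_mat[of _ _ a])
  have "X * msum a (Y # Ys) * mat_adjoint X = X * Y * mat_adjoint X + X * msum a Ys * mat_adjoint X"
    unfolding msum_Cons[OF Y] mult_add_distrib_mat[OF X Y msum_carrier]
    by (rule add_mult_distrib_mat[OF XY aX])
  thus ?case using Cons mult_carrier_mat[OF XY(1) aX] by (simp add: msum_Cons)
qed

lemma conjugate_mult:
  assumes "(X :: complex mat) \<in> carrier_mat c b" "T \<in> carrier_mat b a" "\<sigma> \<in> carrier_mat a a"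
  shows "X * T * \<sigma> * mat_adjoint (X * T) = X * (T * \<sigma> * mat_adjoint T) * mat_adjoint X"
proof -
  have a: "mat_adjoint T \<in> carrier_mat a b" "mat_adjoint X \<in> carrier_mat b c" using assms by auto
  have Ts: "T * \<sigma> \<in> carrier_mat b a" using assms by (intro mult_carrier_mat) auto
  have XTs: "X * (T * \<sigma>) \<in> carrier_mat c a" using assms Ts by (intro mult_carrier_mat) auto
  have "X * T * \<sigma> * mat_adjoint (X * T) = X * (T * \<sigma>) * (mat_adjoint T * mat_adjoint X)"
    using assms by (simp add: mat_adjoint_mult[OF assms(1,2)] assoc_mult_mat[OF assms])
  also have "\<dots> = X * (T * \<sigma>) * mat_adjoint T * mat_adjoint X"
    by (rule assoc_mult_mat[symmetric, OF XTs a])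
  also have "X * (T * \<sigma>) * mat_adjoint T = X * (T * \<sigma> * mat_adjoint T)"
    by (rule assoc_mult_mat[OF assms(1) Ts a(1)])
  finally show ?thesis .
qed

text \<open>Kraus form with operators that respect Schmidt rank. Completeness is stated as
  preservation of the total squared norm of every vector, the form that composes easily and is later
  applied to \<psi> - w.\<close>

definition separable_by ::
    "nat \<Rightarrow> nat \<Rightarrow> nat \<Rightarrow> nat \<Rightarrow> complex mat list \<Rightarrow> (complex mat \<Rightarrow> complex mat) \<Rightarrow> bool" where
  "separable_by a b c d Xs \<L> \<longleftrightarrow> (\<forall>X \<in> set Xs. local_op a b c d X) \<and>
     (\<forall>v \<in> carrier_vec (a * b). (\<Sum>X\<leftarrow>Xs. vnorm2 (X *\<^sub>v v)) = vnorm2 v) \<and>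
     (\<forall>\<sigma> \<in> carrier_mat (a * b) (a * b). \<L> \<sigma> = msum (c * d) (map (\<lambda>X. X * \<sigma> * mat_adjoint X) Xs))"

text \<open>Common form of a round by either party: \<open>Ts i\<close> are the Kraus operators of
  outcome i, \<open>\<L>' i\<close> is the continuation. The products of both are the Kraus
  operators of the whole, and the norms add up by summing over the continuation first.\<close>

lemma separable_round:
  assumes T: "\<And>i. i < m \<Longrightarrow> \<forall>T \<in> set (Ts i). local_op a b (a' i) (b' i) T"
    and Tn: "\<And>v. v \<in> carrier_vec (a * b) \<Longrightarrow> (\<Sum>i<m. \<Sum>T\<leftarrow>Ts i. vnorm2 (T *\<^sub>v v)) = vnorm2 v"
    and X: "\<And>i. i < m \<Longrightarrow> \<exists>Xs. separable_by (a' i) (b' i) c d Xs (\<L>' i)"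
    and \<L>: "\<And>\<sigma>. \<sigma> \<in> carrier_mat (a * b) (a * b) \<Longrightarrow> \<L> \<sigma> =
      mat_sum (c * d) m (\<lambda>i. \<L>' i (msum (a' i * b' i) (map (\<lambda>T. T * \<sigma> * mat_adjoint T) (Ts i))))"
  shows "\<exists>Xs. separable_by a b c d Xs \<L>"
proof -
  have "\<forall>i. \<exists>Xs. i < m \<longrightarrow> separable_by (a' i) (b' i) c d Xs (\<L>' i)" using X by blast
  then obtain Xs where Xs: "\<And>i. i < m \<Longrightarrow> separable_by (a' i) (b' i) c d (Xs i) (\<L>' i)"
    by metis
  have Tc: "T \<in> carrier_mat (a' i * b' i) (a * b)" if "i < m" "T \<in> set (Ts i)" for i T
    using T that by (auto simp: local_op_def)
  have Xc: "X \<in> carrier_mat (c * d) (a' i * b' i)" if "i < m" "X \<in> set (Xs i)" for i X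
    using Xs that by (auto simp: local_op_def separable_by_def)
  \<comment> \<open>Within a branch the continuation runs outermost, since conjugation by each of
    its operators distributes over the sum produced by the round.\<close>
  define Zs where "Zs = concat (map (\<lambda>i. concat (map (\<lambda>X. map (\<lambda>T. X * T) (Ts i)) (Xs i))) [0..<m])"
  have "local_op a b c d Z" if Z: "Z \<in> set Zs" for Z
  proof -
    obtain i X T where i: "i < m" "X \<in> set (Xs i)" "T \<in> set (Ts i)" "Z = X * T"
      using Z by (auto simp: Zs_def)
    thus ?thesis using T Xs[OF i(1)] local_op_mult[of a b "a' i" "b' i" T c d X]
      by (auto simp: separable_by_def)
  qed
  moreover have "(\<Sum>Z\<leftarrow>Zs. vnorm2 (Z *\<^sub>v v)) = vnorm2 v" if v: "v \<in> carrier_vec (a * b)" for v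
  proof -
    have inner: "(\<Sum>X\<leftarrow>Xs i. \<Sum>T\<leftarrow>Ts i. vnorm2 ((X * T) *\<^sub>v v)) = (\<Sum>T\<leftarrow>Ts i. vnorm2 (T *\<^sub>v v))"
      if i: "i < m" for i
    proof -
      have "(\<Sum>X\<leftarrow>Xs i. \<Sum>T\<leftarrow>Ts i. vnorm2 ((X * T) *\<^sub>v v)) = (\<Sum>X\<leftarrow>Xs i. \<Sum>T\<leftarrow>Ts i. vnorm2 (X *\<^sub>v (T *\<^sub>v v)))"
        using assoc_mult_mat_vec[OF Xc[OF i] Tc[OF i] v]
        by (intro arg_cong[of _ _ sum_list] map_cong refl) auto
      also have "\<dots> = (\<Sum>T\<leftarrow>Ts i. \<Sum>X\<leftarrow>Xs i. vnorm2 (X *\<^sub>v (T *\<^sub>v v)))" by (rule sum_list_swap)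
      also have "\<dots> = (\<Sum>T\<leftarrow>Ts i. vnorm2 (T *\<^sub>v v))"
        using Xs[OF i] mult_mat_vec_carrier[OF Tc[OF i] v]
        by (intro arg_cong[of _ _ sum_list] map_cong refl) (simp add: separable_by_def)
      finally show ?thesis .
    qed
    have "(\<Sum>Z\<leftarrow>Zs. vnorm2 (Z *\<^sub>v v)) = (\<Sum>i\<leftarrow>[0..<m]. \<Sum>X\<leftarrow>Xs i. \<Sum>T\<leftarrow>Ts i. vnorm2 ((X * T) *\<^sub>v v))"
      by (simp add: Zs_def sum_list_concat_map comp_def del: map_concat)
    also have "\<dots> = (\<Sum>i<m. \<Sum>T\<leftarrow>Ts i. vnorm2 (T *\<^sub>v v))"
      using inner by (simp add: sum_list_upt)
    finally show ?thesis using Tn[OF v] by simp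
  qed
  moreover have "\<L> \<sigma> = msum (c * d) (map (\<lambda>X. X * \<sigma> * mat_adjoint X) Zs)"
    if \<sigma>: "\<sigma> \<in> carrier_mat (a * b) (a * b)" for \<sigma>
  proof -
    have "\<L>' i (msum (a' i * b' i) (map (\<lambda>T. T * \<sigma> * mat_adjoint T) (Ts i))) =
        msum (c * d) (concat (map (\<lambda>X. map (\<lambda>T. X * T * \<sigma> * mat_adjoint (X * T)) (Ts i)) (Xs i)))"
      (is "\<L>' i ?s = _") if i: "i < m" for i
    proof -
      have Tcar: "T * \<sigma> * mat_adjoint T \<in> carrier_mat (a' i * b' i) (a' i * b' i)" if "T \<in> set (Ts i)" for T
        using Tc[OF i that] \<sigma> by (intro mult_carrier_mat) auto
      have "\<L>' i ?s = msum (c * d) (map (\<lambda>X. X * ?s * mat_adjoint X) (Xs i))"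
        using Xs[OF i] by (simp add: separable_by_def)
      also have "map (\<lambda>X. X * ?s * mat_adjoint X) (Xs i) =
          map (\<lambda>X. msum (c * d) (map (\<lambda>T. X * T * \<sigma> * mat_adjoint (X * T)) (Ts i))) (Xs i)"
      proof (intro map_cong refl)
        fix X assume X: "X \<in> set (Xs i)"
        have "X * ?s * mat_adjoint X = msum (c * d) (map (\<lambda>Y. X * Y * mat_adjoint X) (map (\<lambda>T. T * \<sigma> * mat_adjoint T) (Ts i)))"
          by (rule conjugate_msum[OF Xc[OF i X]]) (use Tcar in auto)
        also have "map (\<lambda>Y. X * Y * mat_adjoint X) (map (\<lambda>T. T * \<sigma> * mat_adjoint T) (Ts i)) =
            map (\<lambda>T. X * T * \<sigma> * mat_adjoint (X * T)) (Ts i)"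
          using conjugate_mult[OF Xc[OF i X] Tc[OF i] \<sigma>] by simp
        finally show "X * ?s * mat_adjoint X =
            msum (c * d) (map (\<lambda>T. X * T * \<sigma> * mat_adjoint (X * T)) (Ts i))" .
      qed
      finally show ?thesis by (simp add: msum_concat comp_def)
    qed
    hence "\<L> \<sigma> = msum (c * d) (map (\<lambda>i. msum (c * d)
        (concat (map (\<lambda>X. map (\<lambda>T. X * T * \<sigma> * mat_adjoint (X * T)) (Ts i)) (Xs i)))) [0..<m])"
      unfolding \<L>[OF \<sigma>] mat_sum_msum by (intro arg_cong[of _ _ "msum (c * d)"] map_cong refl) auto
    also have "\<dots> = msum (c * d) (map (\<lambda>X. X * \<sigma> * mat_adjoint X) Zs)"
      by (simp add: Zs_def msum_concat map_concat comp_def)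
    finally show ?thesis .
  qed
  ultimately show ?thesis unfolding separable_by_def by blast
qed

text \<open>The first map is a round with a single outcome, the second its continuation.\<close>

lemma separable_comp:
  assumes "separable_by a b a' b' Ys \<L>\<^sub>1" "separable_by a' b' c d Xs \<L>\<^sub>2"
  shows "\<exists>Zs. separable_by a b c d Zs (\<L>\<^sub>2 \<circ> \<L>\<^sub>1)"
proof (rule separable_round[of 1 "\<lambda>_. Ys" a b "\<lambda>_. a'" "\<lambda>_. b'" c d "\<lambda>_. \<L>\<^sub>2"])
  fix \<sigma> :: "complex mat" assume \<sigma>: "\<sigma> \<in> carrier_mat (a * b) (a * b)"
  let ?s = "msum (a' * b') (map (\<lambda>T. T * \<sigma> * mat_adjoint T) Ys)"
  have "\<L>\<^sub>2 ?s \<in> carrier_mat (c * d) (c * d)" using assms by (simp add: separable_by_def)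
  thus "(\<L>\<^sub>2 \<circ> \<L>\<^sub>1) \<sigma> = mat_sum (c * d) 1 (\<lambda>i. \<L>\<^sub>2 ?s)"
    using assms \<sigma> by (simp add: mat_sum_msum msum_singleton separable_by_def)
qed (use assms in \<open>auto simp: separable_by_def\<close>)

lemma kraus_map_msum: "kraus_map d k K \<sigma> = msum d (map (\<lambda>X. X * \<sigma> * mat_adjoint X) (map K [0..<k]))"
  by (simp add: kraus_map_def mat_sum_msum comp_def)

lemma vnorm2_tensor:
  assumes "A \<in> carrier_mat c a" "B \<in> carrier_mat d b" "v \<in> carrier_vec (a * b)"
  shows "vnorm2 (tensor A B *\<^sub>v v) = fro (A * reshape a b v * B\<^sup>T)"
  using reshape_tensor[OF assms] vnorm2_reshape[OF mult_mat_vec_carrier[OF tensor_carrier[OF assms(1,2)] assms(3)]]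
  by simp

text \<open>Induction on the protocol: every round is a case of \<open>separable_round\<close>, with
  the norm identity supplied by \<open>instrument_fro\<close> on the reshaped vector.\<close>

lemma LOCC_separable: "LOCC a b c d \<L> \<Longrightarrow> \<exists>Xs. separable_by a b c d Xs \<L>"
proof (induction rule: LOCC.induct)
  case (Stop a b)
  have "1\<^sub>m (a * b) * \<sigma> * mat_adjoint (1\<^sub>m (a * b)) = \<sigma>" if "\<sigma> \<in> carrier_mat (a * b) (a * b)" for \<sigma> :: "complex mat"
    using that by simp
  hence "separable_by a b a b [1\<^sub>m (a * b)] (\<lambda>\<sigma>. \<sigma>)"
    by (auto simp: separable_by_def local_op_def msum_singleton)
  thus ?case by blast
next
  case (Alice a m a' k K b c d \<L>')
  have car: "K i j \<in> carrier_mat (a' i) a" if "i < m" "j < k i" for i j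
    using Alice that by (auto simp: instrument_def)
  show ?case
  proof (rule separable_round[of m "\<lambda>i. map (\<lambda>j. tensor (K i j) (1\<^sub>m b)) [0..<k i]" a b a' "\<lambda>_. b" c d \<L>'])
    fix v :: "complex vec" assume v: "v \<in> carrier_vec (a * b)"
    have "(\<Sum>i<m. \<Sum>j<k i. vnorm2 (tensor (K i j) (1\<^sub>m b) *\<^sub>v v)) = (\<Sum>i<m. \<Sum>j<k i. fro (K i j * reshape a b v))"
    proof (intro sum.cong refl)
      fix i j assume "i \<in> {..<m}" "j \<in> {..<k i}"
      hence K: "K i j \<in> carrier_mat (a' i) a" using car by auto
      hence "K i j * reshape a b v \<in> carrier_mat (a' i) b" by (intro mult_carrier_mat) auto
      thus "vnorm2 (tensor (K i j) (1\<^sub>m b) *\<^sub>v v) = fro (K i j * reshape a b v)"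
        using vnorm2_tensor[OF K _ v, of "1\<^sub>m b" b] by simp
    qed
    also have "\<dots> = vnorm2 v"
      unfolding vnorm2_reshape[OF v] by (rule instrument_fro[OF Alice(1), of _ b]) simp
    finally show "(\<Sum>i<m. \<Sum>T\<leftarrow>map (\<lambda>j. tensor (K i j) (1\<^sub>m b)) [0..<k i]. vnorm2 (T *\<^sub>v v)) = vnorm2 v"
      by (simp add: sum_list_upt comp_def)
  next
    fix i assume "i < m"
    thus "\<forall>T \<in> set (map (\<lambda>j. tensor (K i j) (1\<^sub>m b)) [0..<k i]). local_op a b (a' i) b T"
      using car by (auto intro!: local_op_tensor)
  qed (use Alice in \<open>auto simp: kraus_map_msum\<close>)
next
  case (Bob b m b' k K a c d \<L>')
  have car: "K i j \<in> carrier_mat (b' i) b" if "i < m" "j < k i" for i j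
    using Bob that by (auto simp: instrument_def)
  show ?case
  proof (rule separable_round[of m "\<lambda>i. map (\<lambda>j. tensor (1\<^sub>m a) (K i j)) [0..<k i]" a b "\<lambda>_. a" b' c d \<L>'])
    fix v :: "complex vec" assume v: "v \<in> carrier_vec (a * b)"
    let ?M = "reshape a b v"
    \<comment> \<open>Bob acts on the column index, so the identity of the instrument is applied to
      the transposed matrix.\<close>
    have "(\<Sum>i<m. \<Sum>j<k i. vnorm2 (tensor (1\<^sub>m a) (K i j) *\<^sub>v v)) = (\<Sum>i<m. \<Sum>j<k i. fro (K i j * ?M\<^sup>T))"
    proof (intro sum.cong refl)
      fix i j assume "i \<in> {..<m}" "j \<in> {..<k i}"
      hence K: "K i j \<in> carrier_mat (b' i) b" using car by auto
      have "vnorm2 (tensor (1\<^sub>m a) (K i j) *\<^sub>v v) = fro (?M * (K i j)\<^sup>T)"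
        using vnorm2_tensor[OF _ K v, of "1\<^sub>m a" a] by (simp add: left_mult_one_mat[of _ a b])
      also have "?M * (K i j)\<^sup>T = (K i j * ?M\<^sup>T)\<^sup>T"
        using transpose_mult[of "K i j" "b' i" b "?M\<^sup>T" a] K by simp
      finally show "vnorm2 (tensor (1\<^sub>m a) (K i j) *\<^sub>v v) = fro (K i j * ?M\<^sup>T)" by (simp add: fro_transpose)
    qed
    also have "\<dots> = fro (?M\<^sup>T)" by (rule instrument_fro[OF Bob(1), of _ a]) simp
    also have "\<dots> = vnorm2 v" by (simp add: fro_transpose vnorm2_reshape[OF v])
    finally show "(\<Sum>i<m. \<Sum>T\<leftarrow>map (\<lambda>j. tensor (1\<^sub>m a) (K i j)) [0..<k i]. vnorm2 (T *\<^sub>v v)) = vnorm2 v"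
      by (simp add: sum_list_upt comp_def)
  next
    fix i assume "i < m"
    thus "\<forall>T \<in> set (map (\<lambda>j. tensor (1\<^sub>m a) (K i j)) [0..<k i]). local_op a b a (b' i) T"
      using car by (auto intro!: local_op_tensor)
  qed (use Bob in \<open>auto simp: kraus_map_msum\<close>)
qed

lemma LOCC1A_separable:
  assumes "\<L> \<in> LOCC1A n" "n > 0"
  shows "\<exists>Xs. separable_by n n n n Xs \<L>"
proof -
  obtain m A U V where L: "\<L> = kraus_map (n * n) m (\<lambda>i. tensor (U i * A i) (V i))"
    and c: "\<And>i. i < m \<Longrightarrow> A i \<in> carrier_mat n n \<and> unitary n (U i) \<and> unitary n (V i)"
    and sum: "mat_sum n m (\<lambda>i. mat_adjoint (A i) * A i) = 1\<^sub>m n"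
    using assms(1) by (auto simp: LOCC1A_def)
  have car: "U i * A i \<in> carrier_mat n n" "V i \<in> carrier_mat n n" if "i < m" for i
    using c[OF that] by (auto simp: unitary_def)
  \<comment> \<open>A single outcome carries all the \<open>A i\<close> as Kraus operators; the
    unitaries then drop out of the norm. The output dimension of an instrument must be positive,
    which is where n > 0 enters.\<close>
  have inst: "instrument n 1 (\<lambda>_. n) (\<lambda>_. m) (\<lambda>_. A)"
    unfolding instrument_def using c assms(2) sum msum_singleton[of "1\<^sub>m n" n]
    by (auto simp: mat_sum_msum[of _ "Suc 0"])
  have "(\<Sum>j<m. vnorm2 (tensor (U j * A j) (V j) *\<^sub>v v)) = vnorm2 v" if v: "v \<in> carrier_vec (n * n)" for v
  proof -
    let ?M = "reshape n n v"
    have "(\<Sum>j<m. vnorm2 (tensor (U j * A j) (V j) *\<^sub>v v)) = (\<Sum>j<m. fro (A j * ?M))"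
    proof (intro sum.cong refl)
      fix j assume "j \<in> {..<m}"
      hence j: "j < m" by simp
      note cj = c[OF j]
      have "vnorm2 (tensor (U j * A j) (V j) *\<^sub>v v) = fro (U j * A j * ?M * (V j)\<^sup>T)"
        by (rule vnorm2_tensor[OF car[OF j] v])
      also have "\<dots> = fro (U j * A j * ?M)"
        using cj car[OF j] unitary_transpose by (intro fro_unitary_right[of n _ _ n]) auto
      also have "U j * A j * ?M = U j * (A j * ?M)"
        using cj by (intro assoc_mult_mat[of _ n n _ n _ n]) (auto simp: unitary_def)
      also have "fro \<dots> = fro (A j * ?M)" using cj by (intro fro_mult_unitary[of n _ _ n]) auto
      finally show "vnorm2 (tensor (U j * A j) (V j) *\<^sub>v v) = fro (A j * ?M)" .
    qed
    also have "\<dots> = vnorm2 v" using instrument_fro[OF inst, of ?M n] by (simp add: vnorm2_reshape[OF v])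
    finally show ?thesis .
  qed
  hence "separable_by n n n n (map (\<lambda>i. tensor (U i * A i) (V i)) [0..<m]) \<L>"
    unfolding separable_by_def L using car
    by (auto simp: kraus_map_msum comp_def sum_list_upt intro!: local_op_tensor)
  thus ?thesis by blast
qed

subsection \<open>Closure of \<open>S_plus\<close> under LOCC\<close>

lemma projector_carrier: "\<psi> \<in> carrier_vec d \<Longrightarrow> projector \<psi> \<in> carrier_mat d d"
  by (auto simp: projector_def)

lemma conjugate_projector:
  assumes X: "X \<in> carrier_mat c a" and \<psi>: "\<psi> \<in> carrier_vec a"
  shows "X * projector \<psi> * mat_adjoint X = projector (X *\<^sub>v \<psi>)"
proof (rule eq_matI)
  let ?P = "projector \<psi>"
  have P: "?P \<in> carrier_mat a a" by (rule projector_carrier[OF \<psi>])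
  have XP: "X * ?P \<in> carrier_mat c a" using X P by (rule mult_carrier_mat)
  fix i j assume "i < dim_row (projector (X *\<^sub>v \<psi>))" "j < dim_col (projector (X *\<^sub>v \<psi>))"
  hence ij: "i < c" "j < c" using X by (auto simp: projector_def)
  have "(X * ?P * mat_adjoint X) $$ (i, j) =
      (\<Sum>q<a. (\<Sum>p<a. X $$ (i, p) * (\<psi> $ p * cnj (\<psi> $ q))) * cnj (X $$ (j, q)))"
  proof -
    have "(X * ?P * mat_adjoint X) $$ (i, j) =
        (\<Sum>q<a. (\<Sum>p<a. X $$ (i, p) * ?P $$ (p, q)) * mat_adjoint X $$ (q, j))"
      using ij X by (simp add: index_mult_mat_sum[OF XP, of _ c] index_mult_mat_sum[OF X P] del: index_mult_mat(1))
    also have "\<dots> = (\<Sum>q<a. (\<Sum>p<a. X $$ (i, p) * (\<psi> $ p * cnj (\<psi> $ q))) * cnj (X $$ (j, q)))"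
      using ij X \<psi> by (intro sum.cong refl arg_cong2[of _ _ _ _ "(*)"]) (auto simp: projector_def)
    finally show ?thesis .
  qed
  also have "\<dots> = (\<Sum>p<a. X $$ (i, p) * \<psi> $ p) * (\<Sum>q<a. cnj (X $$ (j, q) * \<psi> $ q))"
    by (subst mult.commute) (simp add: sum_product sum_distrib_left mult_ac)
  also have "\<dots> = projector (X *\<^sub>v \<psi>) $$ (i, j)"
    using ij X \<psi> by (simp add: projector_def index_mult_mat_vec_sum[OF X \<psi>] del: index_mult_mat_vec)
  finally show "(X * ?P * mat_adjoint X) $$ (i, j) = projector (X *\<^sub>v \<psi>) $$ (i, j)" .
qed (use X in \<open>auto simp: projector_def\<close>)

lemma cscalar_prod_diff_smult:
  assumes "(x :: complex vec) \<in> carrier_vec d" "y \<in> carrier_vec d" "z \<in> carrier_vec d"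
  shows "(x - c \<cdot>\<^sub>v y) \<bullet>c z = x \<bullet>c z - c * (y \<bullet>c z)"
  using assms by (simp add: cscalar_prod_sum[of _ d] algebra_simps sum_subtractf sum_distrib_left)

lemma projector_quadratic_form:
  assumes "\<phi> \<in> carrier_vec d" "u \<in> carrier_vec d"
  shows "(\<Sum>r<d. \<Sum>c<d. cnj (u $ r) * projector \<phi> $$ (r, c) * u $ c) = complex_of_real ((cmod (\<phi> \<bullet>c u))\<^sup>2)"
proof -
  have "(\<Sum>r<d. \<Sum>c<d. cnj (u $ r) * projector \<phi> $$ (r, c) * u $ c) =
      (\<Sum>r<d. \<phi> $ r * cnj (u $ r)) * (\<Sum>c<d. cnj (\<phi> $ c) * u $ c)"
    using assms by (simp add: projector_def sum_product mult_ac)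
  also have "\<dots> = (\<phi> \<bullet>c u) * cnj (\<phi> \<bullet>c u)" using assms by (simp add: cscalar_prod_sum[of _ d])
  finally show ?thesis by (simp add: cmod_square mult.commute)
qed

text \<open>
  A rank-one projector is an extreme point: a vector orthogonal to \<open>\<psi>\<close> is orthogonal to every
  \<open>\<phi>\<close> of positive weight in a decomposition of \<open>projector \<psi>\<close>.
\<close>

lemma projector_mem_S_states:
  assumes \<psi>: "pure_state (n * n) \<psi>" and S: "projector \<psi> \<in> S_states n \<mu>"
  shows "majorizes (schmidt_vector n \<psi>) \<mu>"
proof -
  let ?d = "n * n"
  obtain m p X where eq: "projector \<psi> = mat_sum ?d m (\<lambda>i. complex_of_real (p i) \<cdot>\<^sub>m X i)"
    and p: "\<And>i. i < m \<Longrightarrow> 0 \<le> p i" "(\<Sum>i<m. p i) = 1"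
    and X: "\<And>i. i < m \<Longrightarrow> X i \<in> {projector \<phi> | \<phi>. pure_state ?d \<phi> \<and> majorizes (schmidt_vector n \<phi>) \<mu>}"
    using S unfolding S_states_def mat_convex_hull_def by blast
  have "\<forall>i. \<exists>\<phi>. i < m \<longrightarrow> X i = projector \<phi> \<and> pure_state ?d \<phi> \<and> majorizes (schmidt_vector n \<phi>) \<mu>"
    using X by blast
  then obtain \<phi> where \<phi>: "\<And>i. i < m \<Longrightarrow> X i = projector (\<phi> i) \<and> pure_state ?d (\<phi> i) \<and> majorizes (schmidt_vector n (\<phi> i)) \<mu>"
    by metis
  have \<psi>c: "\<psi> \<in> carrier_vec ?d" "\<psi> \<bullet>c \<psi> = 1" using \<psi> by (auto simp: pure_state_def)
  have \<phi>c: "\<phi> i \<in> carrier_vec ?d" "\<phi> i \<bullet>c \<phi> i = 1" if "i < m" for i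
    using \<phi>[OF that] by (auto simp: pure_state_def)
  have "\<exists>i<m. p i > 0"
  proof (rule ccontr)
    assume "\<not> ?thesis"
    hence "(\<Sum>i<m. p i) \<le> 0" by (intro sum_nonpos) (meson lessThan_iff not_less)
    thus False using p by simp
  qed
  then obtain i where i: "i < m" "p i > 0" by auto
  define c where "c = \<phi> i \<bullet>c \<psi>"
  \<comment> \<open>The component of \<open>\<phi> i\<close> orthogonal to \<psi>. It is shown to be
    zero by evaluating both sides of the decomposition as quadratic forms at
    \<open>u\<close>.\<close>
  define u where "u = \<phi> i - c \<cdot>\<^sub>v \<psi>"
  have u: "u \<in> carrier_vec ?d" using \<phi>c[OF i(1)] \<psi>c by (simp add: u_def)
  have "u \<bullet>c \<psi> = \<phi> i \<bullet>c \<psi> - c * (\<psi> \<bullet>c \<psi>)"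
    unfolding u_def by (rule cscalar_prod_diff_smult) (use \<phi>c[OF i(1)] \<psi>c in auto)
  hence u\<psi>: "\<psi> \<bullet>c u = 0" using \<psi>c cscalar_prod_cnj[OF \<psi>c(1) u] by (simp add: c_def)
  have entry: "(complex_of_real (p j) \<cdot>\<^sub>m X j) $$ (r, s) = complex_of_real (p j) * projector (\<phi> j) $$ (r, s)"
    if "j < m" "r < ?d" "s < ?d" for j r s
    using \<phi>[OF that(1)] projector_carrier[OF \<phi>c(1)[OF that(1)]] that by simp
  have "(\<Sum>r<?d. \<Sum>s<?d. cnj (u $ r) * projector \<psi> $$ (r, s) * u $ s) =
      (\<Sum>r<?d. \<Sum>s<?d. \<Sum>j<m. complex_of_real (p j) * (cnj (u $ r) * projector (\<phi> j) $$ (r, s) * u $ s))"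
    unfolding eq
    by (intro sum.cong refl)
      (auto simp: mat_sum_def entry sum_distrib_left sum_distrib_right mult_ac intro!: sum.cong)
  also have "\<dots> = (\<Sum>r<?d. \<Sum>j<m. \<Sum>s<?d. complex_of_real (p j) * (cnj (u $ r) * projector (\<phi> j) $$ (r, s) * u $ s))"
    by (intro sum.cong refl sum.swap)
  also have "\<dots> = (\<Sum>j<m. \<Sum>r<?d. \<Sum>s<?d. complex_of_real (p j) * (cnj (u $ r) * projector (\<phi> j) $$ (r, s) * u $ s))"
    by (rule sum.swap)
  also have "\<dots> = (\<Sum>j<m. complex_of_real (p j * (cmod (\<phi> j \<bullet>c u))\<^sup>2))"
    by (intro sum.cong refl)
      (simp add: sum_distrib_left[symmetric] projector_quadratic_form[OF \<phi>c(1) u] del: of_real_power)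
  finally have "complex_of_real ((cmod (\<psi> \<bullet>c u))\<^sup>2) = complex_of_real (\<Sum>j<m. p j * (cmod (\<phi> j \<bullet>c u))\<^sup>2)"
    unfolding projector_quadratic_form[OF \<psi>c(1) u] by simp
  hence "(\<Sum>j<m. p j * (cmod (\<phi> j \<bullet>c u))\<^sup>2) = 0" using u\<psi> unfolding of_real_eq_iff by simp
  hence "\<forall>j \<in> {..<m}. p j * (cmod (\<phi> j \<bullet>c u))\<^sup>2 = 0"
    by (subst (asm) sum_nonneg_eq_0_iff) (use p in auto)
  hence \<phi>u: "\<phi> i \<bullet>c u = 0" using i by force
  have "u \<bullet>c u = \<phi> i \<bullet>c u - c * (\<psi> \<bullet>c u)"
    by (subst (1) u_def, rule cscalar_prod_diff_smult) (use \<phi>c[OF i(1)] \<psi>c u in auto)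
  hence "vnorm2 u = 0" using \<phi>u u\<psi> by (simp add: cscalar_prod_self)
  hence u0: "u = 0\<^sub>v ?d" using vnorm2_eq_0[OF u] by simp
  have \<phi>\<psi>: "\<phi> i $ r = c * \<psi> $ r" if "r < ?d" for r
  proof -
    have "u $ r = 0" using u0 that by simp
    thus ?thesis using that \<phi>c[OF i(1)] \<psi>c by (simp add: u_def)
  qed
  have "\<phi> i = c \<cdot>\<^sub>v \<psi>" using \<phi>\<psi> \<phi>c[OF i(1)] \<psi>c by (intro eq_vecI) auto
  hence "vnorm2 (\<phi> i) = (cmod c)\<^sup>2 * vnorm2 \<psi>" by (simp add: vnorm2_smult)
  moreover have "vnorm2 (\<phi> i) = 1" "vnorm2 \<psi> = 1"
    using \<phi>c(2)[OF i(1)] \<psi>c(2) by (simp_all add: cscalar_prod_self)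
  ultimately have "c * cnj c = 1" using complex_norm_square[of c] by simp
  \<comment> \<open>The factor \<open>c\<close> is a phase and cancels in the projector. Since
    \<open>schmidt_vector\<close> sees a vector only through its projector, majorization passes from
    \<open>\<phi> i\<close> to \<psi>.\<close>
  hence "c * x * cnj (c * y) = x * cnj y" for x y
    by (metis (no_types, opaque_lifting) complex_cnj_mult mult.assoc mult.left_commute mult_1)
  hence "projector (\<phi> i) = projector \<psi>"
    unfolding projector_def using \<phi>c[OF i(1)] \<psi>c \<phi>\<psi> by (intro eq_matI) auto
  thus ?thesis using \<phi>[OF i(1)] by (simp add: schmidt_vector_def)
qed

section \<open>Monotonicity of Schmidt vectors and the converse construction\<close>

lemma sum_list_take_map_upt:
  assumes "k \<le> n" shows "sum_list (take k (map f [0..<n])) = (\<Sum>i<k. f i :: real)"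
  using assms by (simp add: take_map sum_list_upt)

lemma sum_split_at: "k \<le> (n :: nat) \<Longrightarrow> (\<Sum>i<n. f i :: real) = (\<Sum>i<k. f i) + (\<Sum>i=k..<n. f i)"
  by (subst sum.union_disjoint[symmetric]) (auto intro!: sum.cong)

text \<open>Singular values are matched by position: place j collects the j-th value of every
  branch. Equality of the totals turns the upper bounds on tails into lower bounds on initial
  sums.\<close>

lemma separable_schmidt_monotone:
  assumes sep: "separable_by n n n n Xs \<L>" and \<psi>: "\<psi> \<in> carrier_vec (n * n)"
    and svd\<psi>: "is_svd n (reshape n n \<psi>) U\<^sub>0 d\<^sub>0 V\<^sub>0"
    and svd: "\<And>i. i < length Xs \<Longrightarrow> is_svd n (reshape n n (Xs ! i *\<^sub>v \<psi>)) (U i) (d i) (V i)"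
    and k: "k \<le> n"
  shows "(\<Sum>j<k. (d\<^sub>0 j)\<^sup>2) \<le> (\<Sum>j<k. \<Sum>i<length Xs. (d i j)\<^sup>2)"
    and "(\<Sum>j<n. \<Sum>i<length Xs. (d i j)\<^sup>2) = (\<Sum>j<n. (d\<^sub>0 j)\<^sup>2)"
proof -
  let ?m = "length Xs" and ?r = "reshape n n"
  have Xc: "Xs ! i \<in> carrier_mat (n * n) (n * n)" if "i < ?m" for i
    using sep that by (auto simp: separable_by_def local_op_def)
  have iso: "(\<Sum>i<?m. vnorm2 (Xs ! i *\<^sub>v v)) = vnorm2 v" if "v \<in> carrier_vec (n * n)" for v
    using sep that by (simp add: separable_by_def sum_list_sum_nth atLeast0LessThan)
  obtain N where N: "N \<in> carrier_mat n n" "rank_le k N" "fro (?r \<psi> - N) = (\<Sum>j=k..<n. (d\<^sub>0 j)\<^sup>2)"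
    using truncated_svd[OF svd\<psi> k] by auto
  \<comment> \<open>Inverse of \<open>reshape\<close>: the truncation N read back as a
    vector.\<close>
  define w where "w = vec (n * n) (\<lambda>t. N $$ (t div n, t mod n))"
  have w: "w \<in> carrier_vec (n * n)" by (simp add: w_def)
  have rw: "?r w = N" using N by (intro eq_matI) (auto simp: w_def block_index_less)
  have rdiff: "?r (x - y) = ?r x - ?r y" if "x \<in> carrier_vec (n * n)" "y \<in> carrier_vec (n * n)" for x y
    using that by (intro eq_matI) (auto simp: block_index_less)
  \<comment> \<open>The image of w competes in every branch without having to be optimal there, so
    each branch gives an inequality.\<close>
  have tail: "(\<Sum>j=k..<n. (d i j)\<^sup>2) \<le> vnorm2 (Xs ! i *\<^sub>v (\<psi> - w))" if i: "i < ?m" for i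
  proof -
    have "rank_le k (?r (Xs ! i *\<^sub>v w))"
      using sep i w rw N by (auto simp: separable_by_def local_op_def)
    hence "(\<Sum>j=k..<n. (d i j)\<^sup>2) \<le> fro (?r (Xs ! i *\<^sub>v \<psi>) - ?r (Xs ! i *\<^sub>v w))"
      by (intro eckart_young[OF svd[OF i] _ _ k]) auto
    also have "?r (Xs ! i *\<^sub>v \<psi>) - ?r (Xs ! i *\<^sub>v w) = ?r (Xs ! i *\<^sub>v \<psi> - Xs ! i *\<^sub>v w)"
      using mult_mat_vec_carrier[OF Xc[OF i]] \<psi> w by (intro rdiff[symmetric]) auto
    also have "Xs ! i *\<^sub>v \<psi> - Xs ! i *\<^sub>v w = Xs ! i *\<^sub>v (\<psi> - w)"
      by (rule mult_minus_distrib_mat_vec[OF Xc[OF i] \<psi> w, symmetric])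
    also have "fro (?r (Xs ! i *\<^sub>v (\<psi> - w))) = vnorm2 (Xs ! i *\<^sub>v (\<psi> - w))"
      using mult_mat_vec_carrier[OF Xc[OF i]] \<psi> w by (intro vnorm2_reshape[symmetric]) auto
    finally show ?thesis .
  qed
  have "(\<Sum>i<?m. \<Sum>j=k..<n. (d i j)\<^sup>2) \<le> (\<Sum>i<?m. vnorm2 (Xs ! i *\<^sub>v (\<psi> - w)))"
    using tail by (intro sum_mono) auto
  also have "\<dots> = vnorm2 (\<psi> - w)" using \<psi> w by (intro iso) auto
  also have "\<dots> = (\<Sum>j=k..<n. (d\<^sub>0 j)\<^sup>2)"
    using vnorm2_reshape[of "\<psi> - w" n n] \<psi> w N rdiff[OF \<psi> w] rw by simp
  finally have tails: "(\<Sum>j=k..<n. \<Sum>i<?m. (d i j)\<^sup>2) \<le> (\<Sum>j=k..<n. (d\<^sub>0 j)\<^sup>2)"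
    by (subst sum.swap)
  have "(\<Sum>j<n. \<Sum>i<?m. (d i j)\<^sup>2) = (\<Sum>i<?m. fro (?r (Xs ! i *\<^sub>v \<psi>)))"
    by (subst sum.swap) (simp add: fro_svd[OF svd])
  also have "\<dots> = (\<Sum>i<?m. vnorm2 (Xs ! i *\<^sub>v \<psi>))"
    using mult_mat_vec_carrier[OF Xc \<psi>] by (simp add: vnorm2_reshape[of _ n n])
  also have "\<dots> = (\<Sum>j<n. (d\<^sub>0 j)\<^sup>2)"
    using iso[OF \<psi>] by (simp add: vnorm2_reshape[OF \<psi>] fro_svd[OF svd\<psi>])
  finally show total: "(\<Sum>j<n. \<Sum>i<?m. (d i j)\<^sup>2) = (\<Sum>j<n. (d\<^sub>0 j)\<^sup>2)" .
  show "(\<Sum>j<k. (d\<^sub>0 j)\<^sup>2) \<le> (\<Sum>j<k. \<Sum>i<?m. (d i j)\<^sup>2)"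
    using tails total sum_split_at[OF k, of "\<lambda>j. \<Sum>i<?m. (d i j)\<^sup>2"] sum_split_at[OF k, of "\<lambda>j. (d\<^sub>0 j)\<^sup>2"]
    by simp
qed

lemma mat_sum_diagm:
  assumes "\<And>j. j < n \<Longrightarrow> (\<Sum>i<m. e i j) = 1"
  shows "mat_sum n m (\<lambda>i. diagm n (e i)) = 1\<^sub>m n"
proof (rule eq_matI)
  fix r c assume "r < dim_row (1\<^sub>m n :: complex mat)" "c < dim_col (1\<^sub>m n :: complex mat)"
  hence "r < n" "c < n" by auto
  thus "mat_sum n m (\<lambda>i. diagm n (e i)) $$ (r, c) = 1\<^sub>m n $$ (r, c)"
    using assms[of r] by (auto simp: mat_sum_def simp flip: of_real_sum)
qed (auto simp: mat_sum_def)

text \<open>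
  Alice measures the state with Schmidt vector \<open>\<nu>\<close> by \<open>diagm n (\<lambda>j. d i j / sqrt (\<nu> j))\<close>. Where \<open>\<nu>\<close>
  vanishes the quotient is junk, and outcome \<open>0\<close> completes the measurement.
\<close>

lemma ensemble_in_S_plus:
  fixes v :: "nat \<Rightarrow> complex vec"
  assumes v: "\<And>i. i < m \<Longrightarrow> v i \<in> carrier_vec (n * n)"
    and svd: "\<And>i. i < m \<Longrightarrow> is_svd n (reshape n n (v i)) (U i) (d i) (V i)"
    and \<nu>: "\<And>j. j < n \<Longrightarrow> \<nu> j = (\<Sum>i<m. (d i j)\<^sup>2)" "(\<Sum>j<n. \<nu> j) = 1"
    and maj: "majorizes (map \<nu> [0..<n]) \<mu>"
  shows "mat_sum (n * n) m (\<lambda>i. projector (v i)) \<in> S_plus n \<mu>"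
proof -
  have s: "unitary n (U i)" "unitary n (V i)" "U i \<in> carrier_mat n n" "V i \<in> carrier_mat n n"
    "reshape n n (v i) = U i * diagm n (d i) * V i" if "i < m" for i
    using svd[OF that] by (auto simp: is_svd_def unitary_def)
  have \<nu>nn: "0 \<le> \<nu> j" if "j < n" for j using \<nu>(1)[OF that] by (simp add: sum_nonneg)
  \<comment> \<open>Holds because each branch is sorted; it makes \<nu> itself a Schmidt vector,
    without rearrangement.\<close>
  have \<nu>dec: "\<nu> j \<le> \<nu> i" if "i \<le> j" "j < n" for i j
    using that \<nu>(1)[of i] \<nu>(1)[of j] svd by (auto simp: is_svd_def intro!: sum_mono power_mono)
  \<comment> \<open>Outcome \<open>0\<close> has to exist in order to complete the measurement; an
    empty ensemble would have total weight 0 instead of 1.\<close>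
  have m: "m > 0"
  proof (rule ccontr)
    assume "\<not> ?thesis"
    hence "(\<Sum>j<n. \<nu> j) = 0" using \<nu>(1) by simp
    thus False using \<nu>(2) by simp
  qed
  \<comment> \<open>A state whose matrix is diagonal with entries \<open>sqrt (\<nu> j)\<close> is
    its own singular value decomposition, with trivial unitaries.\<close>
  define \<psi> where "\<psi> = vec (n * n) (\<lambda>t. diagm n (\<lambda>j. sqrt (\<nu> j)) $$ (t div n, t mod n))"
  have \<psi>: "\<psi> \<in> carrier_vec (n * n)" by (simp add: \<psi>_def)
  have r\<psi>: "reshape n n \<psi> = diagm n (\<lambda>j. sqrt (\<nu> j))"
    by (rule eq_matI) (auto simp: \<psi>_def block_index_less)
  have one: "unitary n (1\<^sub>m n)" by (simp add: unitary_def)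
  have svd\<psi>: "is_svd n (reshape n n \<psi>) (1\<^sub>m n) (\<lambda>j. sqrt (\<nu> j)) (1\<^sub>m n)"
    unfolding is_svd_def r\<psi> using one \<nu>nn \<nu>dec
    by (simp add: left_mult_one_mat[of _ n n] right_mult_one_mat[of _ n n])
  have sv: "schmidt_vector n \<psi> = map \<nu> [0..<n]"
    unfolding schmidt_vector_svd[OF \<psi> svd\<psi>] using \<nu>nn by simp
  have "vnorm2 \<psi> = (\<Sum>j<n. \<nu> j)"
    unfolding vnorm2_reshape[OF \<psi>] fro_svd[OF svd\<psi>] using \<nu>nn by simp
  hence pure: "pure_state (n * n) \<psi>" using \<psi> \<nu>(2) by (simp add: pure_state_def cscalar_prod_self)
  have "mat_sum (n * n) 1 (\<lambda>i. complex_of_real 1 \<cdot>\<^sub>m projector \<psi>) = projector \<psi>"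
    using projector_carrier[OF \<psi>] by (intro eq_matI) (auto simp: mat_sum_def)
  hence S: "projector \<psi> \<in> S_states n \<mu>"
    unfolding S_states_def mat_convex_hull_def using pure maj sv
    by (intro CollectI exI[of _ 1] exI[of _ "\<lambda>_. 1"] exI[of _ "\<lambda>_. projector \<psi>"]) (auto intro!: exI[of _ \<psi>])
  define e where "e i j = (if \<nu> j = 0 then (if i = 0 then 1 else 0) else d i j / sqrt (\<nu> j))" for i j :: nat
  let ?A = "\<lambda>i. diagm n (e i)"
  have e1: "(\<Sum>i<m. e i j * e i j) = 1" if j: "j < n" for j
  proof (cases "\<nu> j = 0")
    case True
    hence "(\<Sum>i<m. e i j * e i j) = (\<Sum>i<m. if i = 0 then 1 else 0)" by (intro sum.cong) (auto simp: e_def)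
    thus ?thesis using m by simp
  next
    case False
    hence "(\<Sum>i<m. e i j * e i j) = (\<Sum>i<m. (d i j)\<^sup>2 / \<nu> j)"
      using \<nu>nn[OF j] by (intro sum.cong) (auto simp: e_def power2_eq_square)
    thus ?thesis using False \<nu>(1)[OF j] by (simp flip: sum_divide_distrib)
  qed
  \<comment> \<open>Where \<open>\<nu> j\<close> vanishes so do all \<open>d i j\<close>, hence the
    default values of \<open>e\<close> are multiplied by 0 and the equation persists.\<close>
  have ed: "e i j * sqrt (\<nu> j) = d i j" if "i < m" "j < n" for i j
  proof (cases "\<nu> j = 0")
    case True
    hence "(\<Sum>i<m. (d i j)\<^sup>2) = 0" using \<nu>(1)[OF that(2)] by simp
    hence "(d i j)\<^sup>2 = 0" using that by (subst (asm) sum_nonneg_eq_0_iff) auto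
    thus ?thesis using True by simp
  qed (use \<nu>nn that in \<open>auto simp: e_def\<close>)
  \<comment> \<open>By \<open>reshape_tensor\<close> the operator of Bob acts through its transpose,
    so \<open>(V i)\<^sup>T\<close> places \<open>V i\<close> on the right and restores the
    decomposition of \<open>v i\<close>.\<close>
  let ?L = "kraus_map (n * n) m (\<lambda>i. tensor (U i * ?A i) ((V i)\<^sup>T))"
  have "?A i * ?A j = ?A j * ?A i" for i j by (simp add: diagm_mult mult.commute)
  moreover have "mat_sum n m (\<lambda>i. mat_adjoint (?A i) * ?A i) = 1\<^sub>m n"
    using mat_sum_diagm[OF e1] by (simp add: diagm_mult)
  ultimately have L: "?L \<in> LOCC1A n"
    unfolding LOCC1A_def using s unitary_transpose
    by (intro CollectI exI[of _ m] exI[of _ ?A] exI[of _ U] exI[of _ "\<lambda>i. (V i)\<^sup>T"]) auto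
  have "tensor (U i * ?A i) ((V i)\<^sup>T) * projector \<psi> * mat_adjoint (tensor (U i * ?A i) ((V i)\<^sup>T)) = projector (v i)"
    (is "?T * _ * _ = _") if i: "i < m" for i
  proof -
    note si = s[OF i]
    have UA: "U i * ?A i \<in> carrier_mat n n" and VT: "(V i)\<^sup>T \<in> carrier_mat n n" using si by auto
    have T: "?T \<in> carrier_mat (n * n) (n * n)" by (rule tensor_carrier[OF UA VT])
    have "reshape n n (?T *\<^sub>v \<psi>) = U i * ?A i * diagm n (\<lambda>j. sqrt (\<nu> j)) * V i"
      using reshape_tensor[OF UA VT \<psi>] r\<psi> by simp
    also have "U i * ?A i * diagm n (\<lambda>j. sqrt (\<nu> j)) = U i * (?A i * diagm n (\<lambda>j. sqrt (\<nu> j)))"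
      using si by (intro assoc_mult_mat[of _ n n _ n _ n]) auto
    also have "?A i * diagm n (\<lambda>j. sqrt (\<nu> j)) = diagm n (d i)"
      unfolding diagm_mult by (rule eq_matI) (use ed[OF i] in auto)
    finally have r: "reshape n n (?T *\<^sub>v \<psi>) = reshape n n (v i)" using si by simp
    have "?T *\<^sub>v \<psi> = v i"
    proof (rule eq_vecI)
      fix t assume "t < dim_vec (v i)"
      hence t: "t < n * n" using v[OF i] by simp
      hence "n > 0" by (cases n) auto
      hence "t div n < n" "t mod n < n" using t by (auto simp: less_mult_imp_div_less)
      thus "(?T *\<^sub>v \<psi>) $ t = v i $ t"
        using arg_cong[OF r, of "\<lambda>M. M $$ (t div n, t mod n)"] by simp
    qed (use T v[OF i] in auto)
    thus ?thesis using conjugate_projector[OF T \<psi>] by simp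
  qed
  hence "?L (projector \<psi>) = mat_sum (n * n) m (\<lambda>i. projector (v i))"
    unfolding kraus_map_def mat_sum_def by (intro cong_mat refl) (auto intro!: sum.cong simp del: index_mult_mat(1))
  thus ?thesis unfolding S_plus_def using L pure S
    by (intro CollectI exI[of _ ?L] exI[of _ \<psi>]) simp
qed

text \<open>The two halves meet by transitivity: \<nu> majorizes the Schmidt vector of the initial
  pure state, which by extremality majorizes \<mu>.\<close>

lemma S_plus_closed_under_LOCC:
  assumes \<rho>: "\<rho> \<in> S_plus n \<mu>" and LOCC: "LOCC n n n n \<L>"
  shows "\<L> \<rho> \<in> S_plus n \<mu>"
proof -
  obtain \<L>\<^sub>1 \<psi> where L1: "\<L>\<^sub>1 \<in> LOCC1A n" and pure: "pure_state (n * n) \<psi>"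
    and S: "projector \<psi> \<in> S_states n \<mu>" and \<rho>_eq: "\<rho> = \<L>\<^sub>1 (projector \<psi>)"
    using \<rho> by (auto simp: S_plus_def)
  have \<psi>: "\<psi> \<in> carrier_vec (n * n)" "vnorm2 \<psi> = 1"
    using pure by (auto simp: pure_state_def cscalar_prod_self)
  \<comment> \<open>In dimension 0 the norm of \<psi> would be an empty sum, not 1.\<close>
  have n: "n > 0" using \<psi> by (cases n) (auto simp: vnorm2_def)
  have maj: "majorizes (schmidt_vector n \<psi>) \<mu>" by (rule projector_mem_S_states[OF pure S])
  obtain Xs where sep: "separable_by n n n n Xs (\<L> \<circ> \<L>\<^sub>1)"
    using separable_comp LOCC1A_separable[OF L1 n] LOCC_separable[OF LOCC] by metis
  let ?m = "length Xs"
  have Xc: "Xs ! i \<in> carrier_mat (n * n) (n * n)" if "i < ?m" for i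
    using sep that by (auto simp: separable_by_def local_op_def)
  define v where "v i = Xs ! i *\<^sub>v \<psi>" for i
  have v: "v i \<in> carrier_vec (n * n)" if "i < ?m" for i
    using mult_mat_vec_carrier[OF Xc[OF that] \<psi>(1)] by (simp add: v_def)
  have "\<L> \<rho> = msum (n * n) (map (\<lambda>X. X * projector \<psi> * mat_adjoint X) Xs)"
    using sep projector_carrier[OF \<psi>(1)] by (simp add: separable_by_def \<rho>_eq)
  also have "map (\<lambda>X. X * projector \<psi> * mat_adjoint X) Xs = map (\<lambda>i. projector (v i)) [0..<?m]"
    by (rule nth_equalityI) (use conjugate_projector[OF Xc \<psi>(1)] in \<open>auto simp: v_def\<close>)
  finally have out: "\<L> \<rho> = mat_sum (n * n) ?m (\<lambda>i. projector (v i))" by (simp add: mat_sum_msum)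
  obtain U\<^sub>0 d\<^sub>0 V\<^sub>0 where svd0: "is_svd n (reshape n n \<psi>) U\<^sub>0 d\<^sub>0 V\<^sub>0" using svd_exists by (meson reshape_carrier)
  have "\<forall>i. \<exists>U d V. is_svd n (reshape n n (v i)) U d V" using svd_exists by (meson reshape_carrier)
  then obtain U d V where svd: "\<And>i. is_svd n (reshape n n (v i)) (U i) (d i) (V i)" by metis
  \<comment> \<open>There is no division by probabilities: over all j these sums add up to the
    squared norm of \<psi>, which is 1.\<close>
  define \<nu> where "\<nu> j = (\<Sum>i<?m. (d i j)\<^sup>2)" for j
  note mono = separable_schmidt_monotone[OF sep \<psi>(1) svd0 svd[unfolded v_def], folded \<nu>_def]
  have sv: "schmidt_vector n \<psi> = map (\<lambda>i. (d\<^sub>0 i)\<^sup>2) [0..<n]" by (rule schmidt_vector_svd[OF \<psi>(1) svd0])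
  have len: "length \<mu> = n" using maj sv by (simp add: majorizes_def)
  have "majorizes (map \<nu> [0..<n]) \<mu>"
    unfolding majorizes_def
  proof (intro conjI ballI)
    fix k assume k: "k \<in> {1..length \<mu>}"
    hence kn: "k \<le> n" using len by simp
    have "sum_list (take k \<mu>) \<le> sum_list (take k (schmidt_vector n \<psi>))"
      using maj k by (simp add: majorizes_def)
    also have "\<dots> = (\<Sum>j<k. (d\<^sub>0 j)\<^sup>2)" unfolding sv by (rule sum_list_take_map_upt[OF kn])
    also have "\<dots> \<le> (\<Sum>j<k. \<nu> j)" by (rule mono(1)[OF kn])
    also have "\<dots> = sum_list (take k (map \<nu> [0..<n]))" by (rule sum_list_take_map_upt[OF kn, symmetric])
    finally show "sum_list (take k (map \<nu> [0..<n])) \<ge> sum_list (take k \<mu>)" .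
  qed (simp add: len)
  moreover have "(\<Sum>j<n. \<nu> j) = 1"
    using mono(2)[OF le_refl] \<psi> fro_svd[OF svd0] by (simp add: vnorm2_reshape[OF \<psi>(1)])
  ultimately show ?thesis
    unfolding out using v svd \<nu>_def by (intro ensemble_in_S_plus[of _ v n U d V \<nu>]) auto
qed

theorem corollary2:
  fixes n :: nat and \<rho>\<^sub>1 \<rho>\<^sub>2 :: "complex mat"
  assumes "density_operator (n * n) \<rho>\<^sub>1"
    and "density_operator (n * n) \<rho>\<^sub>2"
    and "\<exists>\<psi> \<mu>. pure_state (n * n) \<psi> \<and> schmidt_vector n \<psi> = \<mu> \<and>
           \<rho>\<^sub>1 \<in> S_plus n \<mu> \<and> \<rho>\<^sub>2 \<notin> S_plus n \<mu>"
  shows "\<not> LOCC_convertible n \<rho>\<^sub>1 \<rho>\<^sub>2"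
  using assms(3) S_plus_closed_under_LOCC unfolding LOCC_convertible_def by blast

end
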